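(* Let $d\in\{2,3\}$, let $\Omega\subset\mathbb{R}^d$ be a bounded simply connected open set with Lipschitz boundary and unit outward normal $\nu$, let $k>0$ be such that $k^2$ is not a Dirichlet eigenvalue of $-\Delta$ in $\Omega$, and let $D=\bigcup_{j=1}^J D_j\subset\Omega$, $D_j=x_j+\epsilon B_j$, be a union of small volume regions as described in the context. Let $f\in H^{1/2}(\partial\Omega)$ and let $u^s\in H^1(\Omega)$ be the solution of $\Delta u^s+k^2u^s=\rho\chi_D$ in $\Omega$, $u^s|_{\partial\Omega}=f$. Then for every $v\in H^1(\Omega)$ solving the Helmholtz equation $\Delta v+k^2v=0$ in $\Omega$, the reciprocity gap functional $$R[v]=\int_{\partial\Omega}v\,\partial_\nu u^s-u^s\,\partial_\nu v\,ds$$ satisfies $$R[v]=\epsilon^d\sum_{j=1}^J|B_j|\,\mathrm{Avg}(\rho_j)\,v(x_j)+\mathcal{O}(\epsilon^{d+1})\quad\text{as }\epsilon\to0.$$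
   Context: Geometry: $J\in\mathbb{N}$; $x_1,\dots,x_J\in\Omega$ are fixed points with $|x_i-x_j|\ge c_0>0$ for $i\ne j$; each $B_j$ is a fixed bounded domain with Lipschitz boundary, centered at the origin, $|B_j|=\mathcal{O}(1)$; $0<\epsilon\ll1$ is a small parameter; $D_j=x_j+\epsilon B_j$, the $D_j$ are pairwise disjoint, $D=\bigcup_{j=1}^JD_j$, and $\mathrm{dist}(D,\partial\Omega)>0$. Source: $\rho\in L^\infty(D)$ with $\|\rho\|_{L^\infty(D)}$ bounded independently of $\epsilon$. $\chi_D$ is the indicator function of $D$. $\mathrm{Avg}(\rho_j)=|D_j|^{-1}\int_{D_j}\rho\,dx$. The boundary integrals are understood as bilinear dual pairings between $H^{1/2}(\partial\Omega)$ and $H^{-1/2}(\partial\Omega)$. The constant in $\mathcal{O}(\epsilon^{d+1})$ is independent of $\epsilon$ (it may depend on $v$). *)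

theory Defs
  imports "HOL-Analysis.Analysis" "HOL-Library.Landau_Symbols"
begin

section \<open>Smooth functions and test functions\<close>

definition pd :: "'a \<Rightarrow> ('a::euclidean_space \<Rightarrow> complex) \<Rightarrow> 'a \<Rightarrow> complex" where
  "pd b \<phi> x = frechet_derivative \<phi> (at x) b"

definition laplacian :: "('a::euclidean_space \<Rightarrow> complex) \<Rightarrow> 'a \<Rightarrow> complex" where
  "laplacian \<phi> x = (\<Sum>b\<in>Basis. pd b (pd b \<phi>) x)"

primrec diff_times :: "nat \<Rightarrow> ('a::euclidean_space \<Rightarrow> complex) \<Rightarrow> bool" where
  "diff_times 0 \<phi> \<longleftrightarrow> continuous_on UNIV \<phi>"
| "diff_times (Suc n) \<phi> \<longleftrightarrow>
     (\<forall>x. \<phi> differentiable (at x)) \<and> (\<forall>b\<in>Basis. diff_times n (pd b \<phi>))"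

definition smooth :: "('a::euclidean_space \<Rightarrow> complex) \<Rightarrow> bool" where
  "smooth \<phi> \<longleftrightarrow> (\<forall>n. diff_times n \<phi>)"

definition test_functions :: "'a::euclidean_space set \<Rightarrow> ('a \<Rightarrow> complex) set" where
  "test_functions \<Omega> =
     {\<phi>. smooth \<phi> \<and> compact (closure {x. \<phi> x \<noteq> 0}) \<and> closure {x. \<phi> x \<noteq> 0} \<subseteq> \<Omega>}"


section \<open>Sobolev spaces on a domain\<close>

text \<open>Elements of function spaces are functions, not equivalence classes modulo null sets;
  values outside \<open>\<Omega>\<close> are irrelevant. All integral pairings are bilinear (no conjugation).\<close>

definition L2 :: "'a::euclidean_space set \<Rightarrow> ('a \<Rightarrow> complex) set" where
  "L2 \<Omega> = {u. u \<in> borel_measurable (lebesgue_on \<Omega>) \<and>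
              integrable (lebesgue_on \<Omega>) (\<lambda>x. (cmod (u x))\<^sup>2)}"

definition has_weak_pderiv ::
  "'a::euclidean_space set \<Rightarrow> 'a \<Rightarrow> ('a \<Rightarrow> complex) \<Rightarrow> ('a \<Rightarrow> complex) \<Rightarrow> bool" where
  "has_weak_pderiv \<Omega> b u w \<longleftrightarrow>
     (\<forall>\<phi>\<in>test_functions \<Omega>.
        (LINT x|lebesgue_on \<Omega>. u x * pd b \<phi> x) = - (LINT x|lebesgue_on \<Omega>. w x * \<phi> x))"

definition H1 :: "'a::euclidean_space set \<Rightarrow> ('a \<Rightarrow> complex) set" where
  "H1 \<Omega> = {u \<in> L2 \<Omega>. \<forall>b\<in>Basis. \<exists>w\<in>L2 \<Omega>. has_weak_pderiv \<Omega> b u w}"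

definition weak_pderiv ::
  "'a::euclidean_space set \<Rightarrow> 'a \<Rightarrow> ('a \<Rightarrow> complex) \<Rightarrow> 'a \<Rightarrow> complex" where
  "weak_pderiv \<Omega> b u = (SOME w. w \<in> L2 \<Omega> \<and> has_weak_pderiv \<Omega> b u w)"

definition H1_norm :: "'a::euclidean_space set \<Rightarrow> ('a \<Rightarrow> complex) \<Rightarrow> real" where
  "H1_norm \<Omega> u = sqrt ((LINT x|lebesgue_on \<Omega>. (cmod (u x))\<^sup>2) +
     (\<Sum>b\<in>Basis. LINT x|lebesgue_on \<Omega>. (cmod (weak_pderiv \<Omega> b u x))\<^sup>2))"

definition has_weak_laplacian ::
  "'a::euclidean_space set \<Rightarrow> ('a \<Rightarrow> complex) \<Rightarrow> ('a \<Rightarrow> complex) \<Rightarrow> bool" where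
  "has_weak_laplacian \<Omega> u h \<longleftrightarrow>
     (\<forall>\<phi>\<in>test_functions \<Omega>.
        (LINT x|lebesgue_on \<Omega>. u x * laplacian \<phi> x) = (LINT x|lebesgue_on \<Omega>. h x * \<phi> x))"

text \<open>\<open>\<Delta>u + k\<^sup>2u = g\<close> in \<open>\<Omega>\<close> in the sense of distributions, for \<open>u\<close> in \<open>H1 \<Omega>\<close>.\<close>

definition helmholtz ::
  "'a::euclidean_space set \<Rightarrow> real \<Rightarrow> ('a \<Rightarrow> complex) \<Rightarrow> ('a \<Rightarrow> complex) \<Rightarrow> bool" where
  "helmholtz \<Omega> k u g \<longleftrightarrow>
     u \<in> H1 \<Omega> \<and> has_weak_laplacian \<Omega> u (\<lambda>x. g x - complex_of_real (k\<^sup>2) * u x)"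

text \<open>Solutions of the homogeneous equation are determined only almost everywhere;
  their point values are those of the continuous representative.\<close>

definition point_value ::
  "'a::euclidean_space set \<Rightarrow> ('a \<Rightarrow> complex) \<Rightarrow> 'a \<Rightarrow> complex" where
  "point_value \<Omega> v x = (THE c. \<exists>w. continuous_on \<Omega> w \<and>
     (AE y in lebesgue_on \<Omega>. w y = v y) \<and> w x = c)"


section \<open>Lipschitz boundaries and surface measure\<close>

definition lipschitz_boundary :: "'a::euclidean_space set \<Rightarrow> bool" where
  "lipschitz_boundary \<Omega> \<longleftrightarrow>
     (\<forall>p\<in>frontier \<Omega>. \<exists>r>0. \<exists>e L \<gamma>. norm e = 1 \<and> L-lipschitz_on {y. y \<bullet> e = 0} \<gamma> \<and>
        \<Omega> \<inter> ball p r = {x \<in> ball p r. x \<bullet> e > \<gamma> (x - (x \<bullet> e) *\<^sub>R e)})"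

text \<open>The \<open>s\<close>-dimensional Hausdorff measure (\<open>s > 0\<close>), normalised so as to give the usual
  surface area; it is countably additive on Borel sets.\<close>

definition hausdorff_outer :: "nat \<Rightarrow> 'a::euclidean_space set \<Rightarrow> ennreal" where
  "hausdorff_outer s A = (SUP \<delta>\<in>{0<..}.
     INF C\<in>{C :: nat \<Rightarrow> 'a set. A \<subseteq> (\<Union>i. C i) \<and> (\<forall>i. bounded (C i) \<and> diameter (C i) \<le> \<delta>)}.
       \<Sum>i. ennreal (unit_ball_vol (real s) * (diameter (C i) / 2) ^ s))"

definition hausdorff_measure :: "nat \<Rightarrow> 'a::euclidean_space measure" where
  "hausdorff_measure s = measure_of UNIV (sets borel) (hausdorff_outer s)"

definition surface :: "'a::euclidean_space set \<Rightarrow> 'a measure" where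
  "surface \<Omega> = restrict_space (hausdorff_measure (DIM('a) - 1)) (frontier \<Omega>)"


section \<open>Traces, the spaces of order one half on the boundary, normal derivatives\<close>

definition L2_boundary :: "'a::euclidean_space set \<Rightarrow> ('a \<Rightarrow> complex) set" where
  "L2_boundary \<Omega> = {f. f \<in> borel_measurable (surface \<Omega>) \<and>
                       integrable (surface \<Omega>) (\<lambda>x. (cmod (f x))\<^sup>2)}"

definition slobodeckij :: "'a::euclidean_space set \<Rightarrow> ('a \<Rightarrow> complex) \<Rightarrow> ennreal" where
  "slobodeckij \<Omega> f =
     (\<integral>\<^sup>+x. \<integral>\<^sup>+y. ennreal ((cmod (f x - f y))\<^sup>2 / dist x y ^ DIM('a)) \<partial>surface \<Omega> \<partial>surface \<Omega>)"

definition H_half :: "'a::euclidean_space set \<Rightarrow> ('a \<Rightarrow> complex) set" where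
  "H_half \<Omega> = {f \<in> L2_boundary \<Omega>. slobodeckij \<Omega> f < \<infinity>}"

definition H_half_norm :: "'a::euclidean_space set \<Rightarrow> ('a \<Rightarrow> complex) \<Rightarrow> real" where
  "H_half_norm \<Omega> f = sqrt ((LINT x|surface \<Omega>. (cmod (f x))\<^sup>2) + enn2real (slobodeckij \<Omega> f))"

text \<open>\<open>H\<^sup>-\<^sup>1\<^sup>/\<^sup>2(\<partial>\<Omega>)\<close> is the space of bounded complex-linear functionals on \<open>H_half \<Omega>\<close>;
  the bilinear dual pairing of \<open>\<psi>\<close> and \<open>g\<close> is \<open>\<psi> g\<close>.\<close>

definition H_minus_half :: "'a::euclidean_space set \<Rightarrow> (('a \<Rightarrow> complex) \<Rightarrow> complex) set" where
  "H_minus_half \<Omega> = {\<psi>.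
     (\<forall>f\<in>H_half \<Omega>. \<forall>g\<in>H_half \<Omega>. \<psi> (\<lambda>x. f x + g x) = \<psi> f + \<psi> g) \<and>
     (\<forall>c. \<forall>f\<in>H_half \<Omega>. \<psi> (\<lambda>x. c * f x) = c * \<psi> f) \<and>
     (\<exists>C. \<forall>f\<in>H_half \<Omega>. cmod (\<psi> f) \<le> C * H_half_norm \<Omega> f)}"

text \<open>The trace operator is the continuous extension of the restriction map
  \<open>\<phi> \<mapsto> \<phi>|\<partial>\<Omega>\<close> from functions smooth up to the boundary to \<open>H1 \<Omega>\<close>; here by its graph.\<close>

definition has_trace ::
  "'a::euclidean_space set \<Rightarrow> ('a \<Rightarrow> complex) \<Rightarrow> ('a \<Rightarrow> complex) \<Rightarrow> bool" where
  "has_trace \<Omega> u f \<longleftrightarrow> u \<in> H1 \<Omega> \<and> f \<in> L2_boundary \<Omega> \<and>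
     (\<exists>\<phi> :: nat \<Rightarrow> 'a \<Rightarrow> complex. (\<forall>n. smooth (\<phi> n)) \<and>
        (\<lambda>n. H1_norm \<Omega> (\<lambda>x. \<phi> n x - u x)) \<longlonglongrightarrow> 0 \<and>
        (\<lambda>n. LINT x|surface \<Omega>. (cmod (\<phi> n x - f x))\<^sup>2) \<longlonglongrightarrow> 0)"

text \<open>The outward normal derivative of \<open>u \<in> H1 \<Omega>\<close> with \<open>\<Delta>u\<close> square integrable, as an element of
  \<open>H_minus_half \<Omega>\<close>: for such \<open>u\<close> the product of \<open>\<nu>\<close> with the gradient has no pointwise meaning
  on the boundary, and the normal derivative is the functional
  \<open>\<langle>\<partial>\<^sub>\<nu>u, w|\<partial>\<Omega>\<rangle> = \<integral>\<^sub>\<Omega> \<nabla>u \<cdot> \<nabla>w + \<Delta>u w\<close>, \<open>w \<in> H1 \<Omega>\<close>.\<close>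

definition has_normal_derivative ::
  "'a::euclidean_space set \<Rightarrow> ('a \<Rightarrow> complex) \<Rightarrow> (('a \<Rightarrow> complex) \<Rightarrow> complex) \<Rightarrow> bool" where
  "has_normal_derivative \<Omega> u \<psi> \<longleftrightarrow> u \<in> H1 \<Omega> \<and> \<psi> \<in> H_minus_half \<Omega> \<and>
     (\<exists>h\<in>L2 \<Omega>. has_weak_laplacian \<Omega> u h) \<and>
     (\<forall>h\<in>L2 \<Omega>. has_weak_laplacian \<Omega> u h \<longrightarrow>
        (\<forall>w\<in>H1 \<Omega>. \<forall>g\<in>H_half \<Omega>. has_trace \<Omega> w g \<longrightarrow>
           \<psi> g = (LINT x|lebesgue_on \<Omega>.
                    (\<Sum>b\<in>Basis. weak_pderiv \<Omega> b u x * weak_pderiv \<Omega> b w x) + h x * w x)))"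

text \<open>\<open>\<integral>\<^sub>\<partial>\<^sub>\<Omega> v \<partial>\<^sub>\<nu>u - u \<partial>\<^sub>\<nu>v ds\<close> in terms of the Cauchy data
  \<open>(u|\<partial>\<Omega>, \<partial>\<^sub>\<nu>u)\<close> and \<open>(v|\<partial>\<Omega>, \<partial>\<^sub>\<nu>v)\<close>.\<close>

definition reciprocity_gap ::
  "('a \<Rightarrow> complex) \<times> (('a \<Rightarrow> complex) \<Rightarrow> complex) \<Rightarrow>
   ('a \<Rightarrow> complex) \<times> (('a \<Rightarrow> complex) \<Rightarrow> complex) \<Rightarrow> complex" where
  "reciprocity_gap U V = snd U (fst V) - snd V (fst U)"

definition cauchy_data ::
  "'a::euclidean_space set \<Rightarrow> ('a \<Rightarrow> complex) \<Rightarrow>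
   ('a \<Rightarrow> complex) \<times> (('a \<Rightarrow> complex) \<Rightarrow> complex) \<Rightarrow> bool" where
  "cauchy_data \<Omega> u U \<longleftrightarrow>
     fst U \<in> H_half \<Omega> \<and> has_trace \<Omega> u (fst U) \<and> has_normal_derivative \<Omega> u (snd U)"

definition dirichlet_eigenvalue :: "'a::euclidean_space set \<Rightarrow> real \<Rightarrow> bool" where
  "dirichlet_eigenvalue \<Omega> \<mu> \<longleftrightarrow>
     (\<exists>u\<in>H1 \<Omega>. \<not> (AE x in lebesgue_on \<Omega>. u x = 0) \<and>
        has_weak_laplacian \<Omega> u (\<lambda>x. - complex_of_real \<mu> * u x) \<and> has_trace \<Omega> u (\<lambda>_. 0))"


section \<open>Small volume regions\<close>

definition region :: "'a::euclidean_space \<Rightarrow> real \<Rightarrow> 'a set \<Rightarrow> 'a set" where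
  "region z \<epsilon> S = (\<lambda>y. z + \<epsilon> *\<^sub>R y) ` S"

definition regions ::
  "nat \<Rightarrow> (nat \<Rightarrow> 'a::euclidean_space) \<Rightarrow> (nat \<Rightarrow> 'a set) \<Rightarrow> real \<Rightarrow> 'a set" where
  "regions J z B \<epsilon> = (\<Union>j\<in>{1..J}. region (z j) \<epsilon> (B j))"

text \<open>Deliberately weak: it holds when \<open>0 \<in> S\<close>, when the centroid of \<open>S\<close> is \<open>0\<close>,
  and when \<open>S = - S\<close> is nonempty.\<close>

definition centered_at_origin :: "'a::euclidean_space set \<Rightarrow> bool" where
  "centered_at_origin S \<longleftrightarrow> 0 \<in> convex hull S"

definition avg :: "'a::euclidean_space set \<Rightarrow> ('a \<Rightarrow> complex) \<Rightarrow> complex" where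
  "avg S \<rho> = (LINT x|lebesgue_on S. \<rho> x) / complex_of_real (measure lebesgue S)"

end

theory Submission
  imports Defs
begin

text \<open>Inserting the trace of \<open>v\<close> into \<open>\<partial>\<^sub>\<nu>u\<close> and the trace of \<open>u\<close> into \<open>\<partial>\<^sub>\<nu>v\<close>, the gradient
  terms and the terms with \<open>k\<^sup>2\<close> cancel, and what remains of \<open>R[v]\<close> is \<open>\<integral>\<^sub>D \<rho> v\<close>
  (\<open>reciprocity_gap_eq_source_integral\<close>). On \<open>D\<^sub>j\<close> the function \<open>v\<close> differs from \<open>v(x\<^sub>j)\<close>
  by \<open>O(\<epsilon>)\<close>, because \<open>v\<close> is Lipschitz near \<open>x\<^sub>j\<close>, and \<open>|D\<^sub>j| = \<epsilon>\<^sup>d |B\<^sub>j|\<close>; this gives the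
  expansion (\<open>region_integral_bigo\<close>).

  The substance is therefore interior regularity: a function \<open>g\<close> in \<open>L\<^sup>2\<close> with
  \<open>\<Delta>g = - \<kappa> g\<close> in the sense of distributions is almost everywhere equal to a locally
  Lipschitz function (\<open>weak_helmholtz_regularity\<close>). The proof is a quantitative form of Weyl's
  lemma. Take a radial bump \<open>\<eta>\<close> of integral \<open>1\<close> with
  \<open>2\<^sup>d \<eta>(2 x) - \<eta>(x) = \<Delta>\<Theta>(x)\<close> for a test function \<open>\<Theta>\<close>
  (\<open>radial_kernels_exist\<close>), and let \<open>V\<^sub>n\<close> be the convolution of \<open>g\<close> with
  \<open>2\<^sup>n\<^sup>d \<eta>(2\<^sup>n x)\<close>. Testing the equation with the dilates of \<open>\<Theta>\<close> gives
  \<open>V\<^sub>n\<^sub>+\<^sub>1 - V\<^sub>n = - \<kappa> 4\<^sup>-\<^sup>n g * \<Theta>\<^sub>n\<close>, where \<open>\<Theta>\<^sub>n(x) = 2\<^sup>n\<^sup>d \<Theta>(2\<^sup>n x)\<close>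
  (\<open>mollify_step\<close>). Two elementary bounds then make the increments summable.
  \<^item> With \<open>g\<close> in \<open>L\<^sup>2\<close> the increments decay geometrically if \<open>d \<le> 3\<close>, by the inequality of
    Cauchy and Schwarz (\<open>mollify_bound_L2\<close>); so \<open>V\<^sub>n\<close> converges and is locally bounded.
    Its limit is \<open>g\<close> almost everywhere (\<open>mollify_limit_AE\<close>), so \<open>g\<close> is locally bounded.
  \<^item> With \<open>g\<close> bounded the increments have Lipschitz constants of order \<open>2\<^sup>-\<^sup>n\<close>
    (\<open>mollify_diff_bound_L_infinity\<close>), so the limit is Lipschitz.\<close>

section \<open>Smooth functions of one real variable\<close>

primrec diff_times_real :: "nat \<Rightarrow> (real \<Rightarrow> real) \<Rightarrow> bool" where
  "diff_times_real 0 F \<longleftrightarrow> True"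
| "diff_times_real (Suc n) F \<longleftrightarrow>
     (\<exists>F'. (\<forall>s. (F has_real_derivative F' s) (at s)) \<and> diff_times_real n F')"

definition smooth_real :: "(real \<Rightarrow> real) \<Rightarrow> bool" where
  "smooth_real F \<longleftrightarrow> (\<forall>n. diff_times_real n F)"

lemma diff_times_real_SucI:
  "(\<And>s. (F has_real_derivative F' s) (at s)) \<Longrightarrow> diff_times_real n F' \<Longrightarrow> diff_times_real (Suc n) F"
  by auto

lemma smooth_realI_deriv:
  assumes "\<And>s. (F has_real_derivative F' s) (at s)" "smooth_real F'"
  shows "smooth_real F"
  unfolding smooth_real_def
proof
  fix n show "diff_times_real n F"
    using assms by (cases n) (auto simp: smooth_real_def)
qed

lemma smooth_real_deriv:
  assumes "smooth_real F" "\<And>s. (F has_real_derivative F' s) (at s)"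
  shows "smooth_real F'"
  unfolding smooth_real_def
proof
  fix n
  have "diff_times_real (Suc n) F" using assms(1) by (simp only: smooth_real_def)
  then obtain G where G: "\<And>s. (F has_real_derivative G s) (at s)" "diff_times_real n G" by auto
  have "G = F'" using DERIV_unique[OF G(1) assms(2)] by auto
  then show "diff_times_real n F'" using G by simp
qed

lemma smooth_real_obtain_deriv:
  assumes "smooth_real F"
  obtains F' where "\<And>s. (F has_real_derivative F' s) (at s)" "smooth_real F'"
proof -
  have "diff_times_real (Suc 0) F" using assms by (simp only: smooth_real_def)
  then obtain F' where "\<And>s. (F has_real_derivative F' s) (at s)" by auto
  with smooth_real_deriv[OF assms this] that show thesis by blast
qed

lemma smooth_real_continuous: "smooth_real F \<Longrightarrow> continuous_on S F"
  by (meson DERIV_isCont continuous_at_imp_continuous_on smooth_real_obtain_deriv)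

lemma diff_times_real_mono: "diff_times_real (Suc n) F \<Longrightarrow> diff_times_real n F"
proof (induction n arbitrary: F)
  case (Suc n)
  then obtain F' where "\<And>s. (F has_real_derivative F' s) (at s)" "diff_times_real (Suc n) F'"
    by auto
  with Suc.IH show ?case by auto
qed simp

lemma diff_times_real_const: "diff_times_real n (\<lambda>_. c)"
proof (induction n arbitrary: c)
  case (Suc n)
  show ?case by (rule diff_times_real_SucI[OF DERIV_const Suc])
qed simp

lemma diff_times_real_add:
  "diff_times_real n F \<Longrightarrow> diff_times_real n G \<Longrightarrow> diff_times_real n (\<lambda>s. F s + G s)"
proof (induction n arbitrary: F G)
  case (Suc n)
  then obtain F' G' where FG: "\<And>s. (F has_real_derivative F' s) (at s)" "diff_times_real n F'"
    "\<And>s. (G has_real_derivative G' s) (at s)" "diff_times_real n G'"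
    by auto
  show ?case by (rule diff_times_real_SucI[OF DERIV_add[OF FG(1,3)] Suc.IH[OF FG(2,4)]])
qed simp

lemma diff_times_real_mult:
  "diff_times_real n F \<Longrightarrow> diff_times_real n G \<Longrightarrow> diff_times_real n (\<lambda>s. F s * G s)"
proof (induction n arbitrary: F G)
  case (Suc n)
  note FG0 = Suc.prems[THEN diff_times_real_mono]
  from Suc obtain F' G' where FG: "\<And>s. (F has_real_derivative F' s) (at s)" "diff_times_real n F'"
    "\<And>s. (G has_real_derivative G' s) (at s)" "diff_times_real n G'"
    by auto
  show ?case
    by (rule diff_times_real_SucI[OF DERIV_mult[OF FG(1,3)]
          diff_times_real_add[OF Suc.IH[OF FG(2) FG0(2)] Suc.IH[OF FG(4) FG0(1)]]])
qed simp

lemma diff_times_real_affine: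
  "diff_times_real n F \<Longrightarrow> diff_times_real n (\<lambda>s. F (a * s + b))"
proof (induction n arbitrary: F)
  case (Suc n)
  then obtain F' where F: "\<And>s. (F has_real_derivative F' s) (at s)" "diff_times_real n F'" by auto
  have "((\<lambda>s. F (a * s + b)) has_real_derivative F' (a * s + b) * a) (at s)" for s
    by (rule DERIV_chain2[OF F(1)]) (auto intro!: derivative_eq_intros)
  then show ?case
    by (rule diff_times_real_SucI)
      (rule diff_times_real_mult[OF Suc.IH[OF F(2)] diff_times_real_const])
qed simp

text \<open>Multiplication by a power of the variable, which is smooth away from \<open>0\<close> only, is harmless
  for functions that vanish near \<open>(-\<infinity>, 0]\<close>.\<close>

lemma DERIV_vanishing:
  fixes F :: "real \<Rightarrow> real"
  assumes "(F has_real_derivative D) (at s)" "\<And>t. t < r \<Longrightarrow> F t = 0" "s < r"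
  shows "D = 0"
proof -
  have "((\<lambda>_. 0) has_real_derivative D) (at s)"
    by (rule has_field_derivative_transform_within_open[OF assms(1), of "{..<r}"])
      (use assms in auto)
  then show ?thesis using DERIV_unique DERIV_const by blast
qed

lemma diff_times_real_powr_mult:
  assumes "r > 0"
  shows "diff_times_real n F \<Longrightarrow> (\<And>s. s < r \<Longrightarrow> F s = 0) \<Longrightarrow> diff_times_real n (\<lambda>s. s powr p * F s)"
proof (induction n arbitrary: F p)
  case (Suc n)
  from Suc.prems obtain F' where F: "\<And>s. (F has_real_derivative F' s) (at s)" "diff_times_real n F'"
    by auto
  have F'0: "F' s = 0" if "s < r" for s using DERIV_vanishing[OF F(1) Suc.prems(2) that] by simp
  have "((\<lambda>s. s powr p * F s) has_real_derivative
          (s powr (p - 1) * (p * F s) + s powr p * F' s)) (at s)" for s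
  proof (cases "s < r")
    case True
    have "((\<lambda>_. 0) has_real_derivative 0) (at s)" by simp
    then have "((\<lambda>s. s powr p * F s) has_real_derivative 0) (at s)"
      by (rule has_field_derivative_transform_within_open[of _ _ _ "{..<r}"])
        (use Suc.prems True in auto)
    then show ?thesis using Suc.prems(2)[OF True] F'0[OF True] by simp
  next
    case False
    then have "s > 0" using assms by simp
    then have "((\<lambda>s. s powr p) has_real_derivative p * s powr (p - 1)) (at s)"
      by (rule has_real_derivative_powr)
    from DERIV_mult[OF this F(1)] show ?thesis by (simp add: mult_ac add_ac)
  qed
  then show ?case
  proof (rule diff_times_real_SucI[OF _ diff_times_real_add])
    show "diff_times_real n (\<lambda>s. s powr (p - 1) * (p * F s))"
      by (rule Suc.IH[OF diff_times_real_mult[OF diff_times_real_const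
              diff_times_real_mono[OF Suc.prems(1)]]]) (simp add: Suc.prems(2))
    show "diff_times_real n (\<lambda>s. s powr p * F' s)"
      by (rule Suc.IH[OF F(2) F'0])
  qed
qed simp

lemma smooth_real_intros:
  "smooth_real (\<lambda>_. c)"
  "smooth_real F \<Longrightarrow> smooth_real G \<Longrightarrow> smooth_real (\<lambda>s. F s + G s)"
  "smooth_real F \<Longrightarrow> smooth_real G \<Longrightarrow> smooth_real (\<lambda>s. F s * G s)"
  "smooth_real F \<Longrightarrow> smooth_real (\<lambda>s. F (a * s + b))"
  "r > 0 \<Longrightarrow> smooth_real F \<Longrightarrow> (\<And>s. s < r \<Longrightarrow> F s = 0) \<Longrightarrow> smooth_real (\<lambda>s. s powr p * F s)"
  unfolding smooth_real_def
  by (auto intro: diff_times_real_const diff_times_real_add diff_times_real_mult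
      diff_times_real_affine diff_times_real_powr_mult)

lemma smooth_real_diff: 
  assumes "smooth_real F" "smooth_real G" shows "smooth_real (\<lambda>s. F s - G s)"
  using smooth_real_intros(2)[OF assms(1) smooth_real_intros(3)[OF smooth_real_intros(1)[of "-1"] assms(2)]]
  by simp

text \<open>For \<open>m = 0\<close> this is the smooth flat function \<open>exp (- 1 / s)\<close>. Dividing by powers of \<open>s\<close> makes the family closed under
  differentiation.\<close>

definition flat :: "nat \<Rightarrow> real \<Rightarrow> real" where
  "flat m s = (if s > 0 then exp (- inverse s) * inverse s ^ m else 0)"

lemma flat_tendsto_0: "(flat m \<longlongrightarrow> 0) (at 0)"
proof -
  have "((\<lambda>x::real. x ^ m / exp x) \<longlongrightarrow> 0) at_top" by (rule tendsto_power_div_exp_0)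
  then have "((\<lambda>s::real. inverse s ^ m / exp (inverse s)) \<longlongrightarrow> 0) (at_right 0)"
    by (rule filterlim_compose[OF _ filterlim_inverse_at_top_right])
  then have 1: "(flat m \<longlongrightarrow> 0) (at_right 0)"
    by (rule Lim_transform_eventually)
      (auto simp: flat_def eventually_at_right_field exp_minus field_simps intro!: exI[of _ 1])
  have 2: "(flat m \<longlongrightarrow> 0) (at_left 0)"
    by (rule Lim_transform_eventually[OF tendsto_const])
      (auto simp: flat_def eventually_at_left_field intro!: exI[of _ "-1"])
  show ?thesis using 1 2 by (simp add: filterlim_split_at)
qed

lemma flat_deriv:
  "(flat m has_real_derivative (flat (m + 2) s + (- real m) * flat (m + 1) s)) (at s)"
proof -
  consider "s > 0" | "s < 0" | "s = 0" by linarith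
  then show ?thesis
  proof cases
    case 1
    have "((\<lambda>s. exp (- inverse s) * inverse s ^ m) has_real_derivative
        (flat (m + 2) s + (- real m) * flat (m + 1) s)) (at s)"
    proof -
      have "((\<lambda>s. inverse s) has_real_derivative - (inverse s * inverse s)) (at s)"
        using DERIV_inverse[of s UNIV] 1 by (simp add: power2_eq_square)
      note I = this
      have "((\<lambda>s. inverse s ^ m) has_real_derivative
          real m * inverse s ^ (m - 1) * - (inverse s * inverse s)) (at s)"
        using DERIV_power[OF I, of m] by (simp add: mult_ac)
      moreover have "((\<lambda>s. exp (- inverse s)) has_real_derivative
          exp (- inverse s) * (inverse s * inverse s)) (at s)"
        using DERIV_chain2[OF DERIV_exp DERIV_minus[OF I]] by simp
      ultimately have "((\<lambda>s. exp (- inverse s) * inverse s ^ m) has_real_derivative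
          exp (- inverse s) * (inverse s * inverse s) * inverse s ^ m +
          real m * inverse s ^ (m - 1) * - (inverse s * inverse s) * exp (- inverse s)) (at s)"
        by (intro DERIV_mult)
      moreover have "real m * inverse s ^ (m - 1) * (inverse s * inverse s)
          = real m * (inverse s ^ m * inverse s)"
        by (cases m) simp_all
      then have "exp (- inverse s) * (inverse s * inverse s) * inverse s ^ m +
          real m * inverse s ^ (m - 1) * - (inverse s * inverse s) * exp (- inverse s)
          = flat (m + 2) s + (- real m) * flat (m + 1) s"
        using 1 by (simp add: flat_def mult_ac)
      ultimately show ?thesis by simp
    qed
    then show ?thesis
      by (rule has_field_derivative_transform_within_open[of _ _ _ "{0<..}"])
        (use 1 in \<open>auto simp: flat_def\<close>)
  next
    case 2
    have "((\<lambda>_. 0) has_real_derivative 0) (at s)" by simp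
    then have "(flat m has_real_derivative 0) (at s)"
      by (rule has_field_derivative_transform_within_open[of _ _ _ "{..<0}"])
        (use 2 in \<open>auto simp: flat_def\<close>)
    then show ?thesis using 2 by (simp add: flat_def)
  next
    case 3
    have "(\<lambda>h. (flat m (0 + h) - flat m 0) / h) = flat (m + 1)"
      by (auto simp: flat_def divide_inverse)
    then have "(flat m has_real_derivative 0) (at 0)"
      using flat_tendsto_0[of "m + 1"] by (simp add: DERIV_def)
    then show ?thesis using 3 by (simp add: flat_def)
  qed
qed

lemma smooth_real_flat: "smooth_real (flat m)"
proof -
  have "diff_times_real n (flat m)" for n
  proof (induction n arbitrary: m)
    case (Suc n)
    show ?case
      by (rule diff_times_real_SucI[OF flat_deriv])
        (intro diff_times_real_add diff_times_real_mult diff_times_real_const Suc)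
  qed simp
  then show ?thesis by (simp add: smooth_real_def)
qed

lemma smooth_real_antiderivative:
  assumes "smooth_real F"
  obtains G where "smooth_real G" "\<And>s. (G has_real_derivative F s) (at s)" "G a = 0"
proof -
  have "isCont F s" for s
    using smooth_real_continuous[OF assms, of UNIV] by (simp add: continuous_on_eq_continuous_at)
  then have "\<exists>G. \<forall>s. -\<infinity> < ereal s \<longrightarrow> ereal s < \<infinity> \<longrightarrow> (G has_vector_derivative F s) (at s)"
    by (intro einterval_antiderivative) auto
  then obtain G where G: "\<And>s. (G has_real_derivative F s) (at s)"
    by (auto simp: has_real_derivative_iff_has_vector_derivative)
  have G': "((\<lambda>s. G s - G a) has_real_derivative F s) (at s)" for s
    using DERIV_diff[OF G DERIV_const] by simp
  show thesis
    by (rule that[of "\<lambda>s. G s - G a"]) (use G' smooth_realI_deriv[OF G' assms] in auto)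
qed

lemma DERIV_zero_imp_constant_on:
  fixes G :: "real \<Rightarrow> real"
  assumes "convex S" "\<And>s. (G has_real_derivative F s) (at s)" "\<And>s. s \<in> S \<Longrightarrow> F s = 0"
    "a \<in> S" "b \<in> S"
  shows "G a = G b"
proof -
  have "\<exists>c. \<forall>s\<in>S. G s = c"
  proof (rule has_field_derivative_zero_constant[OF assms(1)])
    fix s assume "s \<in> S"
    then show "(G has_real_derivative 0) (at s within S)"
      using has_field_derivative_at_within[OF assms(2), of s S] assms(3) by simp
  qed
  then show ?thesis using assms(4,5) by auto
qed

text \<open>For a radial function \<open>\<theta>(|x|\<^sup>2)\<close> in dimension \<open>d\<close> the Laplacian is \<open>4 s \<theta>'' + 2 d \<theta>'\<close> at
  \<open>s = |x|\<^sup>2\<close>, so the last identity says that \<open>2\<^sup>d \<eta>(|2 x|\<^sup>2) - \<eta>(|x|\<^sup>2)\<close> is the Laplacian of a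
  function supported in the unit ball. The idea behind the construction: the fundamental solution
  of the Laplacian has \<open>s\<close>-derivative proportional to \<open>s powr (- d/2)\<close>, and cutting this off
  near \<open>0\<close> by \<open>\<sigma>\<close> gives a function \<open>N\<close> with Laplacian \<open>\<eta>\<close>, supported where \<open>\<sigma>' \<noteq> 0\<close>.
  Rescaling \<open>N\<close> does not change its behaviour outside the unit ball, up to a constant, so
  that the difference of \<open>N\<close> and its rescaling can be taken to have compact support.\<close>

lemma radial_kernels_exist:
  fixes d :: nat
  obtains \<theta> \<theta>' \<theta>'' \<eta> :: "real \<Rightarrow> real" where
    "smooth_real \<theta>" "\<And>s. (\<theta> has_real_derivative \<theta>' s) (at s)"
    "\<And>s. (\<theta>' has_real_derivative \<theta>'' s) (at s)" "smooth_real \<eta>"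
    "\<And>s. s \<ge> 1 \<Longrightarrow> \<theta> s = 0" "\<And>s. s \<ge> 1 \<Longrightarrow> \<eta> s = 0"
    "\<And>s. \<eta> s \<ge> 0" "\<eta> (1/2) > 0"
    "\<And>s. 4 * s * \<theta>'' s + 2 * real d * \<theta>' s = 2 ^ d * \<eta> (4 * s) - \<eta> s"
proof -
  define \<beta> where "\<beta> s = flat 0 (1 * s + (-1/4)) * flat 0 ((-1) * s + 1)" for s
  have \<beta>: "smooth_real \<beta>" unfolding \<beta>_def by (intro smooth_real_intros smooth_real_flat)
  have \<beta>0: "\<beta> s = 0" if "s \<le> 1/4 \<or> s \<ge> 1" for s using that by (auto simp: \<beta>_def flat_def)
  obtain \<sigma> where \<sigma>: "smooth_real \<sigma>" "\<And>s. (\<sigma> has_real_derivative \<beta> s) (at s)" "\<sigma> (1/4) = 0"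
    using smooth_real_antiderivative[OF \<beta>] by metis
  have \<sigma>0: "\<sigma> s = 0" if "s \<le> 1/4" for s
    using DERIV_zero_imp_constant_on[OF _ \<sigma>(2), of "{..1/4}" s "1/4"] \<beta>0 that \<sigma>(3) by auto
  have \<sigma>1: "\<sigma> s = \<sigma> 1" if "s \<ge> 1" for s
    using DERIV_zero_imp_constant_on[OF _ \<sigma>(2), of "{1..}" s 1] \<beta>0 that by auto
  \<comment> \<open>The factor of \<open>s powr (- d/2)\<close> in \<open>2\<^sup>d h(4 s) - h(s)\<close> for \<open>h(s) = s powr (- d/2) * \<sigma>(s)\<close>, the
    derivative of the cut-off fundamental solution; it vanishes where \<open>\<sigma>\<close> is constant.\<close>
  define F where "F s = \<sigma> (4 * s + 0) - \<sigma> s" for s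
  have F: "smooth_real F" unfolding F_def by (intro smooth_real_diff smooth_real_intros \<sigma>)
  have F0: "F s = 0" if "s < 1/16 \<or> s \<ge> 1" for s
    using that \<sigma>0[of s] \<sigma>0[of "4 * s"] \<sigma>1[of s] \<sigma>1[of "4 * s"] by (auto simp: F_def)
  define \<theta>' where "\<theta>' s = s powr (- (d/2)) * F s" for s
  have \<theta>': "smooth_real \<theta>'"
    unfolding \<theta>'_def by (rule smooth_real_intros(5)[of "1/16", OF _ F]) (auto intro: F0)
  define \<eta> where "\<eta> s = s powr (1 - d/2) * (4 * \<beta> s)" for s
  have \<eta>: "smooth_real \<eta>"
    unfolding \<eta>_def
    by (rule smooth_real_intros(5)[of "1/4"])
      (auto intro!: smooth_real_intros \<beta> \<beta>0)
  obtain \<theta> where \<theta>: "smooth_real \<theta>" "\<And>s. (\<theta> has_real_derivative \<theta>' s) (at s)" "\<theta> 1 = 0"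
    using smooth_real_antiderivative[OF \<theta>'] by metis
  have \<theta>1: "\<theta> s = 0" if "s \<ge> 1" for s
    using DERIV_zero_imp_constant_on[OF _ \<theta>(2), of "{1..}" s 1] F0 that \<theta>(3) by (auto simp: \<theta>'_def)
  obtain \<theta>'' where \<theta>'': "\<And>s. (\<theta>' has_real_derivative \<theta>'' s) (at s)"
    using smooth_real_obtain_deriv[OF \<theta>'] by metis
  have main: "4 * s * \<theta>'' s + 2 * real d * \<theta>' s = 2 ^ d * \<eta> (4 * s) - \<eta> s" for s
  proof (cases "s > 0")
    case True
    have "((\<lambda>s. \<sigma> (4 * s + 0)) has_real_derivative \<beta> (4 * s + 0) * 4) (at s)"
      by (rule DERIV_chain2[OF \<sigma>(2)]) (auto intro!: derivative_eq_intros)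
    from DERIV_diff[OF this \<sigma>(2)] have *: "(F has_real_derivative (4 * \<beta> (4 * s) - \<beta> s)) (at s)"
      unfolding F_def by (simp add: mult_ac)
    have "((\<lambda>s. s powr (- (d/2))) has_real_derivative - (d/2) * s powr (- (d/2) - 1)) (at s)"
      using True by (rule has_real_derivative_powr)
    from DERIV_mult[OF this *] have "(\<theta>' has_real_derivative
       (s powr (- (d/2)) * (4 * \<beta> (4 * s) - \<beta> s) - (d/2) * s powr (- (d/2) - 1) * F s)) (at s)"
      unfolding \<theta>'_def by (simp add: algebra_simps)
    then have eq: "\<theta>'' s = s powr (- (d/2)) * (4 * \<beta> (4 * s) - \<beta> s) - (d/2) * s powr (- (d/2) - 1) * F s"
      using DERIV_unique[OF \<theta>''] by blast
    have p1: "s * s powr (- (d/2)) = s powr (1 - d/2)"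
      using True powr_add[of s 1 "- (d/2)"] by simp
    have p2: "s * s powr (- (d/2) - 1) = s powr (- (d/2))"
      using True powr_add[of s 1 "- (d/2) - 1"] by simp
    have "4 powr (d/2) = (2 powr 2) powr (d/2)" by simp
    also have "\<dots> = 2 ^ d" by (simp only: powr_powr) (simp add: powr_realpow)
    finally have "2 ^ d * 4 powr (1 - d/2) = 4" by (simp add: powr_diff)
    then have p3: "2 ^ d * (4 * s) powr (1 - d/2) = 4 * s powr (1 - d/2)"
      using True by (simp add: powr_mult)
    have "4 * s * \<theta>'' s + 2 * real d * \<theta>' s = 4 * (s * s powr (- (d/2))) * (4 * \<beta> (4 * s) - \<beta> s)
         - 2 * real d * (s * s powr (- (d/2) - 1)) * F s + 2 * real d * \<theta>' s"
      unfolding eq by (simp add: algebra_simps)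
    also have "\<dots> = 4 * s powr (1 - d/2) * (4 * \<beta> (4 * s) - \<beta> s)"
      unfolding p1 p2 \<theta>'_def by simp
    also have "\<dots> = (2 ^ d * (4 * s) powr (1 - d/2)) * (4 * \<beta> (4 * s)) - \<eta> s"
      unfolding p3 \<eta>_def by (simp add: algebra_simps)
    finally show ?thesis by (simp add: \<eta>_def)
  next
    case False
    have "\<theta>'' s = 0"
      by (rule DERIV_vanishing[OF \<theta>'', of "1/16"]) (use False F0 in \<open>auto simp: \<theta>'_def\<close>)
    with False show ?thesis by (simp add: \<theta>'_def \<eta>_def \<beta>0 F0)
  qed
  have "\<eta> s \<ge> 0" for s by (auto simp: \<eta>_def \<beta>_def flat_def)
  moreover have "\<eta> (1/2) > 0" by (simp add: \<eta>_def \<beta>_def flat_def)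
  moreover have "\<eta> s = 0" if "s \<ge> 1" for s using \<beta>0 that by (simp add: \<eta>_def)
  ultimately show thesis
    using \<theta>1 main by (intro that[OF \<theta>(1,2) \<theta>'' \<eta>]) auto
qed

section \<open>Radial test functions\<close>

lemma pd_eqI: "(\<phi> has_derivative D) (at x) \<Longrightarrow> pd b \<phi> x = D b"
  unfolding pd_def by (metis frechet_derivative_at)

lemma diff_times_SucI:
  assumes "\<And>x. (\<phi> has_derivative \<phi>' x) (at x)" "\<And>b. b \<in> Basis \<Longrightarrow> diff_times n (\<lambda>x. \<phi>' x b)"
  shows "diff_times (Suc n) \<phi>"
proof -
  have "pd b \<phi> = (\<lambda>x. \<phi>' x b)" for b
    using pd_eqI[OF assms(1)] by (rule ext)
  then show ?thesis using assms by (auto simp: differentiable_def)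
qed

lemma diff_times_SucD:
  assumes "diff_times (Suc n) \<phi>"
  obtains \<phi>' where "\<And>x. (\<phi> has_derivative \<phi>' x) (at x)" "\<And>b. b \<in> Basis \<Longrightarrow> diff_times n (\<lambda>x. \<phi>' x b)"
proof
  show "(\<phi> has_derivative frechet_derivative \<phi> (at x)) (at x)" for x
    using assms frechet_derivative_works by auto
  show "diff_times n (\<lambda>x. frechet_derivative \<phi> (at x) b)" if "b \<in> Basis" for b
    using assms that by (auto simp: pd_def[abs_def])
qed

lemma diff_times_mono: "diff_times (Suc n) \<phi> \<Longrightarrow> diff_times n \<phi>"
proof (induction n arbitrary: \<phi>)
  case 0
  then show ?case
    by (auto intro!: continuous_at_imp_continuous_on differentiable_imp_continuous_within)
qed auto

lemma diff_times_const: "diff_times n (\<lambda>_. c)"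
proof (induction n arbitrary: c)
  case (Suc n)
  show ?case by (rule diff_times_SucI[OF has_derivative_const Suc])
qed simp

lemma diff_times_add:
  "diff_times n \<phi> \<Longrightarrow> diff_times n \<psi> \<Longrightarrow> diff_times n (\<lambda>x. \<phi> x + \<psi> x)"
proof (induction n arbitrary: \<phi> \<psi>)
  case (Suc n)
  obtain \<phi>' \<psi>' where D: "\<And>x. (\<phi> has_derivative \<phi>' x) (at x)" "\<And>b. b \<in> Basis \<Longrightarrow> diff_times n (\<lambda>x. \<phi>' x b)"
    "\<And>x. (\<psi> has_derivative \<psi>' x) (at x)" "\<And>b. b \<in> Basis \<Longrightarrow> diff_times n (\<lambda>x. \<psi>' x b)"
    using Suc.prems[THEN diff_times_SucD] by metis
  show ?case by (rule diff_times_SucI[OF has_derivative_add[OF D(1,3)] Suc.IH[OF D(2,4)]])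
qed (simp add: continuous_on_add)

lemma diff_times_mult:
  "diff_times n \<phi> \<Longrightarrow> diff_times n \<psi> \<Longrightarrow> diff_times n (\<lambda>x. \<phi> x * \<psi> x)"
proof (induction n arbitrary: \<phi> \<psi>)
  case (Suc n)
  obtain \<phi>' \<psi>' where D: "\<And>x. (\<phi> has_derivative \<phi>' x) (at x)" "\<And>b. b \<in> Basis \<Longrightarrow> diff_times n (\<lambda>x. \<phi>' x b)"
    "\<And>x. (\<psi> has_derivative \<psi>' x) (at x)" "\<And>b. b \<in> Basis \<Longrightarrow> diff_times n (\<lambda>x. \<psi>' x b)"
    using Suc.prems[THEN diff_times_SucD] by metis
  note D0 = Suc.prems[THEN diff_times_mono]
  show ?case
    by (rule diff_times_SucI[OF has_derivative_mult[OF D(1,3)]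
          diff_times_add[OF Suc.IH[OF D0(1) D(4)] Suc.IH[OF D(2) D0(2)]]])
qed (simp add: continuous_on_mult)

lemma has_derivative_minus_const: "((\<lambda>x. x - a) has_derivative (\<lambda>h. h)) (at x within S)"
  using has_derivative_diff[OF has_derivative_ident has_derivative_const] by simp

lemma diff_times_coordinate: "diff_times n (\<lambda>x. complex_of_real ((x - a) \<bullet> b))"
proof (cases n)
  case (Suc m)
  have "((\<lambda>x. complex_of_real ((x - a) \<bullet> b)) has_derivative (\<lambda>h. complex_of_real (h \<bullet> b))) (at x)" for x
    by (rule has_derivative_of_real[OF has_derivative_inner_left[OF has_derivative_minus_const]])
  then show ?thesis unfolding Suc by (rule diff_times_SucI) (rule diff_times_const)
qed (simp add: continuous_on_of_real continuous_on_inner continuous_on_diff)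

lemma has_derivative_radial:
  fixes a :: "'a::euclidean_space"
  assumes "\<And>s. (F has_real_derivative F' s) (at s)"
  shows "((\<lambda>x. F (r * (norm (x - a))\<^sup>2)) has_derivative
           (\<lambda>h. 2 * r * (((x - a) \<bullet> h) * F' (r * (norm (x - a))\<^sup>2)))) (at x)"
proof -
  have "((\<lambda>x. r * (norm (x - a))\<^sup>2) has_derivative (\<lambda>h. 2 * r * ((x - a) \<bullet> h))) (at x)"
    using has_derivative_mult_right[OF has_derivative_inner[OF
        has_derivative_minus_const[of a x UNIV] has_derivative_minus_const[of a x UNIV]], of r]
    unfolding power2_norm_eq_inner by (simp add: inner_commute mult_ac)
  from has_derivative_compose[OF this
      assms[of "r * (norm (x - a))\<^sup>2", unfolded has_field_derivative_def]]
  show ?thesis by (simp add: mult_ac)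
qed

lemma has_derivative_radial_complex:
  fixes a :: "'a::euclidean_space"
  assumes "\<And>s. (F has_real_derivative F' s) (at s)"
  shows "((\<lambda>x. complex_of_real (F (r * (norm (x - a))\<^sup>2))) has_derivative
           (\<lambda>h. complex_of_real (2 * r) * (complex_of_real ((x - a) \<bullet> h) *
             complex_of_real (F' (r * (norm (x - a))\<^sup>2))))) (at x)"
  using has_derivative_of_real[OF has_derivative_radial[OF assms]] by (simp add: mult_ac)

lemma smooth_radial:
  fixes a :: "'a::euclidean_space"
  assumes "smooth_real F"
  shows "smooth (\<lambda>x. complex_of_real (F (r * (norm (x - a))\<^sup>2)))"
proof -
  have "diff_times n (\<lambda>x. complex_of_real (F (r * (norm (x - a))\<^sup>2)))"
    if "smooth_real F" for n and F :: "real \<Rightarrow> real"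
    using that
  proof (induction n arbitrary: F)
    case 0
    have "continuous_on UNIV F" using 0 by (rule smooth_real_continuous)
    then show ?case
      using continuous_on_compose2[of UNIV F UNIV "\<lambda>x. r * (norm (x - a))\<^sup>2"]
      by (simp add: continuous_on_of_real continuous_on_mult continuous_on_norm continuous_on_power
          continuous_on_diff)
  next
    case (Suc n)
    then obtain F' where F': "\<And>s. (F has_real_derivative F' s) (at s)" "smooth_real F'"
      using smooth_real_obtain_deriv by metis
    show ?case
      by (rule diff_times_SucI[OF has_derivative_radial_complex[OF F'(1)]])
        (intro diff_times_mult diff_times_const diff_times_coordinate Suc.IH F')
  qed
  with assms show ?thesis by (simp add: smooth_def)
qed

lemma radial_test_function:
  fixes a :: "'a::euclidean_space"
  assumes "smooth_real F" "\<And>s. s \<ge> 1 \<Longrightarrow> F s = 0" "\<delta> > 0" "r * \<delta>\<^sup>2 = 1" "cball a \<delta> \<subseteq> \<Omega>"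
  shows "(\<lambda>x. complex_of_real (F (r * (norm (x - a))\<^sup>2))) \<in> test_functions \<Omega>"
proof -
  let ?S = "{x. complex_of_real (F (r * (norm (x - a))\<^sup>2)) \<noteq> 0}"
  have r: "r = 1 / \<delta>\<^sup>2" using assms(3,4) by (simp add: field_simps)
  have "?S \<subseteq> cball a \<delta>"
  proof
    fix x assume "x \<in> ?S"
    then have "r * (norm (x - a))\<^sup>2 < 1"
      using assms(2)[of "r * (norm (x - a))\<^sup>2"] by (cases "r * (norm (x - a))\<^sup>2 < 1") auto
    then have "(norm (x - a))\<^sup>2 < \<delta>\<^sup>2" using assms(3) by (simp add: r)
    then show "x \<in> cball a \<delta>"
      using power2_less_imp_less[of "norm (x - a)" \<delta>] assms(3) by (simp add: dist_norm norm_minus_commute)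
  qed
  then have "closure ?S \<subseteq> cball a \<delta>" by (simp add: closure_minimal)
  moreover from this have "compact (closure ?S)"
    by (meson bounded_cball bounded_subset closed_closure compact_eq_bounded_closed)
  ultimately show ?thesis
    using smooth_radial[OF assms(1)] assms(5) by (auto simp: test_functions_def)
qed

lemma laplacian_radial:
  fixes a :: "'a::euclidean_space" and F F' F'' :: "real \<Rightarrow> real"
  assumes "\<And>s. (F has_real_derivative F' s) (at s)" "\<And>s. (F' has_real_derivative F'' s) (at s)"
  shows "laplacian (\<lambda>x. complex_of_real (F (r * (norm (x - a))\<^sup>2))) x =
     complex_of_real (r * (4 * (r * (norm (x - a))\<^sup>2) * F'' (r * (norm (x - a))\<^sup>2)
        + 2 * real DIM('a) * F' (r * (norm (x - a))\<^sup>2)))"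
proof -
  let ?s = "\<lambda>x. r * (norm (x - a))\<^sup>2"
  have 1: "pd b (\<lambda>x. complex_of_real (F (?s x))) = 
      (\<lambda>x. complex_of_real (2 * r) * (complex_of_real ((x - a) \<bullet> b) * complex_of_real (F' (?s x))))" for b
    by (rule ext) (rule pd_eqI[OF has_derivative_radial_complex[OF assms(1)]])
  have 2: "pd b (\<lambda>x. complex_of_real (2 * r) * (complex_of_real ((x - a) \<bullet> b) * complex_of_real (F' (?s x)))) x
     = complex_of_real (4 * r\<^sup>2 * ((x - a) \<bullet> b)\<^sup>2 * F'' (?s x) + 2 * r * F' (?s x))" if b: "b \<in> Basis" for b
  proof -
    have "((\<lambda>x. complex_of_real (2 * r) * (complex_of_real ((x - a) \<bullet> b) * complex_of_real (F' (?s x))))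
      has_derivative (\<lambda>h. complex_of_real (2 * r) * (complex_of_real ((x - a) \<bullet> b) * 
         (complex_of_real (2 * r) * (complex_of_real ((x - a) \<bullet> h) * complex_of_real (F'' (?s x))))
         + complex_of_real (h \<bullet> b) * complex_of_real (F' (?s x))))) (at x)"
      by (rule has_derivative_mult_right[OF has_derivative_mult[OF
            has_derivative_of_real[OF has_derivative_inner_left[OF has_derivative_minus_const]]
            has_derivative_radial_complex[OF assms(2)]]])
    note D = this
    show ?thesis
      unfolding pd_eqI[OF D] using b by (simp add: power2_eq_square distrib_left mult_ac)
  qed
  have "laplacian (\<lambda>x. complex_of_real (F (?s x))) x
     = complex_of_real (\<Sum>b\<in>Basis. 4 * r\<^sup>2 * ((x - a) \<bullet> b)\<^sup>2 * F'' (?s x) + 2 * r * F' (?s x))"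
    unfolding laplacian_def 1 of_real_sum by (rule sum.cong[OF refl 2])
  also have "(\<Sum>b\<in>Basis. 4 * r\<^sup>2 * ((x - a) \<bullet> b)\<^sup>2 * F'' (?s x) + 2 * r * F' (?s x))
     = 4 * r\<^sup>2 * (\<Sum>b\<in>Basis. ((x - a) \<bullet> b)\<^sup>2) * F'' (?s x) + real DIM('a) * (2 * r * F' (?s x))"
    by (simp add: sum.distrib sum_distrib_left sum_distrib_right mult_ac)
  also have "(\<Sum>b\<in>Basis. ((x - a) \<bullet> b)\<^sup>2) = (norm (x - a))\<^sup>2"
    using euclidean_inner[of "x - a" "x - a"] unfolding power2_norm_eq_inner by (simp add: power2_eq_square)
  finally show ?thesis by (simp add: power2_eq_square algebra_simps)
qed

lemma radial_bounds:
  assumes "smooth_real F" "\<And>s. s \<ge> 1 \<Longrightarrow> F s = 0"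
  obtains L where "L \<ge> 0" "\<And>s. s \<ge> 0 \<Longrightarrow> \<bar>F s\<bar> \<le> L"
    "\<And>x y :: 'a::euclidean_space. \<bar>F ((norm x)\<^sup>2) - F ((norm y)\<^sup>2)\<bar> \<le> L * norm (x - y)"
proof -
  obtain F' where F': "\<And>s. (F has_real_derivative F' s) (at s)" "smooth_real F'"
    using smooth_real_obtain_deriv assms by metis
  have "bounded (F ` {0..1})" "bounded (F' ` {0..1})"
    by (intro compact_imp_bounded compact_continuous_image smooth_real_continuous assms F' compact_Icc)+
  then obtain M N where "\<forall>y\<in>F ` {0..1}. norm y \<le> M" "\<forall>y\<in>F' ` {0..1}. norm y \<le> N"
    unfolding bounded_iff by blast
  then have M: "\<And>s. s \<in> {0..1} \<Longrightarrow> \<bar>F s\<bar> \<le> M" and N: "\<And>s. s \<in> {0..1} \<Longrightarrow> \<bar>F' s\<bar> \<le> N"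
    by simp_all
  have pos: "M \<ge> 0" "N \<ge> 0" using M[of 0] N[of 0] by auto
  have F'0: "F' s = 0" if "s > 1" for s
  proof -
    have "((\<lambda>_. 0) has_real_derivative F' s) (at s)"
      by (rule has_field_derivative_transform_within_open[OF F'(1), of "{1<..}"])
        (use that assms in auto)
    then show ?thesis using DERIV_unique DERIV_const by blast
  qed
  have lip: "\<bar>F ((norm x)\<^sup>2) - F ((norm y)\<^sup>2)\<bar> \<le> 2 * N * norm (x - y)" for x y :: 'a
  proof -
    let ?D = "\<lambda>(x::'a) h. 2 * ((x \<bullet> h) * F' ((norm x)\<^sup>2))"
    have "norm (F ((norm x)\<^sup>2) - F ((norm y)\<^sup>2)) \<le> 2 * N * norm (x - y)"
    proof (rule differentiable_bound[of UNIV _ ?D])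
      show "((\<lambda>x::'a. F ((norm x)\<^sup>2)) has_derivative ?D x) (at x within UNIV)" for x
        using has_derivative_radial[OF F'(1), of 1 0 x] by simp
      show "onorm (?D x) \<le> 2 * N" for x :: 'a
      proof (rule onorm_le)
        fix h :: 'a
        have "\<bar>F' ((norm x)\<^sup>2)\<bar> * norm x \<le> N"
        proof (cases "norm x \<le> 1")
          case True
          then have "\<bar>F' ((norm x)\<^sup>2)\<bar> * norm x \<le> N * 1"
            using pos by (intro mult_mono N) (auto simp: power_le_one)
          then show ?thesis by simp
        next
          case False
          then show ?thesis using F'0[of "(norm x)\<^sup>2"] pos by simp
        qed
        then have "\<bar>F' ((norm x)\<^sup>2)\<bar> * (norm x * norm h) \<le> N * norm h"
          unfolding mult.assoc[symmetric] by (intro mult_right_mono) auto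
        moreover have "\<bar>F' ((norm x)\<^sup>2)\<bar> * \<bar>x \<bullet> h\<bar> \<le> \<bar>F' ((norm x)\<^sup>2)\<bar> * (norm x * norm h)"
          by (intro mult_left_mono Cauchy_Schwarz_ineq2) auto
        ultimately show "norm (?D x h) \<le> 2 * N * norm h"
          by (simp add: abs_mult mult_ac)
      qed
    qed auto
    then show ?thesis by simp
  qed
  show thesis
  proof (rule that[of "M + 2 * N"])
    show "\<bar>F s\<bar> \<le> M + 2 * N" if "s \<ge> 0" for s
      using M[of s] assms(2)[of s] that pos by (cases "s \<le> 1") auto
    show "\<bar>F ((norm x)\<^sup>2) - F ((norm y)\<^sup>2)\<bar> \<le> (M + 2 * N) * norm (x - y)" for x y :: 'a
      using lip[of x y] pos by (smt (verit) mult_right_mono norm_ge_zero)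
  qed (use pos in auto)
qed

section \<open>Mollification\<close>

text \<open>The kernel \<open>F(|x|\<^sup>2)\<close>, contracted to radius \<open>2\<^sup>-\<^sup>n\<close> with its integral preserved; the factor
  \<open>4\<^sup>n\<close> stands inside because \<open>F\<close> takes the square of the norm.\<close>

definition dilate :: "(real \<Rightarrow> real) \<Rightarrow> nat \<Rightarrow> 'a::euclidean_space \<Rightarrow> 'a \<Rightarrow> real" where
  "dilate F n x y = 2 ^ (n * DIM('a)) * F (4 ^ n * (norm (y - x))\<^sup>2)"

lemma scaled_norm: "4 ^ n * (norm (y - x))\<^sup>2 = (norm (2 ^ n *\<^sub>R y - 2 ^ n *\<^sub>R x))\<^sup>2"
  unfolding scaleR_diff_right[symmetric]
  by (simp add: power_mult_distrib power_mult[symmetric] mult.commute[of n] power_mult)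

lemma dilate_eq_0:
  assumes "\<And>s. s \<ge> 1 \<Longrightarrow> F s = 0" "(1/2) ^ n \<le> dist x y"
  shows "dilate F n x y = 0"
proof -
  have "1 = 2 ^ n * (1/2::real) ^ n" by (simp flip: power_mult_distrib)
  also have "\<dots> \<le> 2 ^ n * norm (y - x)"
    using assms(2) by (intro mult_left_mono) (auto simp: dist_norm norm_minus_commute)
  finally have "1\<^sup>2 \<le> (2 ^ n * norm (y - x))\<^sup>2" by (intro power_mono) auto
  then have "1 \<le> 4 ^ n * (norm (y - x))\<^sup>2"
    by (simp add: power_mult_distrib power_mult[symmetric] mult.commute[of n] power_mult)
  then show ?thesis using assms(1) by (simp add: dilate_def)
qed

lemma dilate_bound:
  fixes x y :: "'a::euclidean_space"
  assumes "\<And>s. s \<ge> 0 \<Longrightarrow> \<bar>F s\<bar> \<le> L"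
  shows "\<bar>dilate F n x y\<bar> \<le> 2 ^ (n * DIM('a)) * L"
  unfolding dilate_def abs_mult using assms by (auto intro!: mult_mono)

lemma dilate_lipschitz:
  fixes x x' y :: "'a::euclidean_space"
  assumes "\<And>x y :: 'a. \<bar>F ((norm x)\<^sup>2) - F ((norm y)\<^sup>2)\<bar> \<le> L * norm (x - y)"
  shows "\<bar>dilate F n x y - dilate F n x' y\<bar> \<le> 2 ^ (n * DIM('a)) * L * 2 ^ n * dist x x'"
proof -
  let ?u = "\<lambda>x. 2 ^ n *\<^sub>R y - 2 ^ n *\<^sub>R x"
  have "\<bar>F (4 ^ n * (norm (y - x))\<^sup>2) - F (4 ^ n * (norm (y - x'))\<^sup>2)\<bar> \<le> L * norm (?u x - ?u x')"
    unfolding scaled_norm by (rule assms)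
  also have "?u x - ?u x' = 2 ^ n *\<^sub>R (x' - x)" by (simp add: scaleR_diff_right)
  finally have "\<bar>F (4 ^ n * (norm (y - x))\<^sup>2) - F (4 ^ n * (norm (y - x'))\<^sup>2)\<bar> \<le> L * 2 ^ n * dist x x'"
    by (simp add: dist_norm norm_minus_commute)
  then have "2 ^ (n * DIM('a)) * \<bar>F (4 ^ n * (norm (y - x))\<^sup>2) - F (4 ^ n * (norm (y - x'))\<^sup>2)\<bar>
      \<le> 2 ^ (n * DIM('a)) * (L * 2 ^ n * dist x x')"
    by (intro mult_left_mono) auto
  then show ?thesis
    by (simp add: dilate_def abs_mult mult_ac flip: right_diff_distrib)
qed

lemma dilate_measurable:
  assumes "smooth_real F" "f \<in> borel_measurable M" "h \<in> borel_measurable M"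
  shows "(\<lambda>z. dilate F n (f z) (h z)) \<in> borel_measurable M"
proof -
  have [measurable]: "F \<in> borel_measurable borel"
    using smooth_real_continuous[OF assms(1)] by (rule borel_measurable_continuous_onI)
  note assms(2,3) [measurable]
  show ?thesis unfolding dilate_def by measurable
qed

lemma lborel_integral_affine:
  fixes f :: "'a::euclidean_space \<Rightarrow> real"
  assumes [measurable]: "f \<in> borel_measurable borel" and "c \<noteq> 0"
  shows "(LINT x|lborel. f x) = \<bar>c\<bar> ^ DIM('a) * (LINT x|lborel. f (t + c *\<^sub>R x))"
  by (subst lborel_affine[OF assms(2), of t]) (simp add: integral_density integral_distr)

lemma integral_dilate:
  fixes y :: "'a::euclidean_space"
  assumes "smooth_real F"
  shows "(LINT x|lborel. dilate F n x y) = (LINT x|lborel. F ((norm (x::'a))\<^sup>2))"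
proof -
  have [simp]: "4 ^ n * ((1 / 2) ^ n * norm x)\<^sup>2 = (norm x)\<^sup>2" for x :: 'a
  proof -
    have "4 ^ n * ((1/2) ^ n)\<^sup>2 = (1::real)"
      by (simp add: power_mult[symmetric] mult.commute[of n] power_mult power_one_over)
    then show ?thesis by (simp add: power_mult_distrib flip: mult.assoc)
  qed
  have [measurable]: "(\<lambda>x. dilate F n x y) \<in> borel_measurable borel"
    by (rule dilate_measurable[OF assms]) auto
  have "(LINT x|lborel. dilate F n x y) =
     \<bar>(1/2) ^ n\<bar> ^ DIM('a) * (LINT x|lborel. dilate F n (y + (1/2) ^ n *\<^sub>R x) y)"
    by (rule lborel_integral_affine) auto
  also have "(\<lambda>x. dilate F n (y + (1/2) ^ n *\<^sub>R x) y) = (\<lambda>x. 2 ^ (n * DIM('a)) * F ((norm x)\<^sup>2))"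
    by (simp add: dilate_def)
  also have "\<bar>(1/2) ^ n\<bar> ^ DIM('a) * (LINT x|lborel. 2 ^ (n * DIM('a)) * F ((norm (x::'a))\<^sup>2))
      = (LINT x|lborel. F ((norm (x::'a))\<^sup>2))"
    by (simp add: power_mult power_one_over)
  finally show ?thesis .
qed

definition mollify :: "(real \<Rightarrow> real) \<Rightarrow> ('a::euclidean_space \<Rightarrow> complex) \<Rightarrow> nat \<Rightarrow> 'a \<Rightarrow> complex" where
  "mollify F g n x = (LINT y|lborel. g y * complex_of_real (dilate F n x y))"

lemma integrable_mult_dilate:
  fixes g :: "'a::euclidean_space \<Rightarrow> complex"
  assumes "integrable lborel g" "smooth_real F" "\<And>s. s \<ge> 0 \<Longrightarrow> \<bar>F s\<bar> \<le> L"
  shows "integrable lborel (\<lambda>y. g y * complex_of_real (dilate F n x y))"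
proof (rule Bochner_Integration.integrable_bound)
  show "integrable lborel (\<lambda>y. (2 ^ (n * DIM('a)) * L) * norm (g y))"
    using assms(1) by auto
  note [measurable] = dilate_measurable[OF assms(2)] borel_measurable_integrable[OF assms(1)]
  show "(\<lambda>y. g y * complex_of_real (dilate F n x y)) \<in> borel_measurable lborel"
    by measurable
  show "AE y in lborel. norm (g y * complex_of_real (dilate F n x y))
      \<le> norm ((2 ^ (n * DIM('a)) * L) * norm (g y))"
  proof (rule AE_I2)
    fix y
    have "norm (g y) * \<bar>dilate F n x y\<bar> \<le> norm (g y) * (2 ^ (n * DIM('a)) * L)"
      by (intro mult_left_mono dilate_bound[OF assms(3)]) auto
    then show "norm (g y * complex_of_real (dilate F n x y))
      \<le> norm ((2 ^ (n * DIM('a)) * L) * norm (g y))"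
      using assms(3)[of 0] by (simp add: norm_mult abs_mult mult_ac)
  qed
qed

lemma mollify_measurable:
  fixes g :: "'a::euclidean_space \<Rightarrow> complex"
  assumes "g \<in> borel_measurable borel" "smooth_real F"
  shows "mollify F g n \<in> borel_measurable borel"
proof -
  note [measurable] = dilate_measurable[OF assms(2)] assms(1)
  have "(\<lambda>x. LINT y|lborel. g y * complex_of_real (dilate F n x y)) \<in> borel_measurable borel"
    by measurable
  then show ?thesis by (simp add: mollify_def[abs_def])
qed

text \<open>By Fubini the integral of \<open>g * F\<^sub>n\<close> over a box is that of \<open>g\<close> against the mollified indicator
  of the box, which is bounded by \<open>1\<close> and converges to the indicator away from the boundary of
  the box, a null set. Integrals over boxes determine \<open>g\<close>, so that this can replace Lebesgue's
  differentiation theorem.\<close>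

lemma mollify_box_tendsto:
  fixes g :: "'a::euclidean_space \<Rightarrow> complex"
  assumes g: "integrable lborel g" and F: "smooth_real F" "\<And>s. s \<ge> 1 \<Longrightarrow> F s = 0" "\<And>s. F s \<ge> 0"
    and one: "(LINT x|lborel. F ((norm (x::'a))\<^sup>2)) = 1"
  shows "(\<lambda>n. LINT x|lborel. indicator (box a b) x *\<^sub>R mollify F g n x)
           \<longlonglongrightarrow> (LINT x|lborel. indicator (box a b) x *\<^sub>R g x)"
proof -
  obtain L where L: "L \<ge> 0" "\<And>s. s \<ge> 0 \<Longrightarrow> \<bar>F s\<bar> \<le> L"
    using radial_bounds[OF F(1,2)] by metis
  note [measurable] = dilate_measurable[OF F(1)] borel_measurable_integrable[OF g]
  have gm [measurable]: "g \<in> borel_measurable borel" using borel_measurable_integrable[OF g] by simp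
  let ?A = "box a b"
  let ?f = "\<lambda>n x y. indicator ?A x *\<^sub>R (g y * complex_of_real (dilate F n x y))"
  define w where "w n y = (LINT x|lborel. indicator ?A x * dilate F n x y)" for n y
  have int_dil: "integrable lborel (\<lambda>x. dilate F n x y)" for n and y :: 'a
  proof (rule ccontr)
    assume "\<not> ?thesis"
    then have "(LINT x|lborel. dilate F n x y) = 0" by (rule not_integrable_integral_eq)
    then show False using one integral_dilate[OF F(1), of n y] by simp
  qed
  have dil_nonneg: "dilate F n x y \<ge> 0" for n and x y :: 'a using F(3) by (simp add: dilate_def)
  have w_bound: "\<bar>w n y\<bar> \<le> 1" for n y
  proof -
    have "integrable lborel (\<lambda>x. indicator ?A x * dilate F n x y)"
      using integrable_mult_indicator[OF _ int_dil, of ?A n y] by simp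
    then have "w n y \<le> (LINT x|lborel. dilate F n x y)"
      unfolding w_def using dil_nonneg[of n _ y]
      by (intro integral_mono int_dil) (auto simp: indicator_def)
    moreover have "w n y \<ge> 0"
      unfolding w_def by (intro Bochner_Integration.integral_nonneg) (simp add: dil_nonneg)
    ultimately show ?thesis using one integral_dilate[OF F(1), of n y] by simp
  qed
  have swap: "(LINT x|lborel. indicator ?A x *\<^sub>R mollify F g n x) = (LINT y|lborel. g y * complex_of_real (w n y))" for n
  proof -
    let ?C = "2 ^ (n * DIM('a)) * L"
    have "integrable (lborel \<Otimes>\<^sub>M lborel) (\<lambda>(x::'a, y). indicator ?A x * norm (g y))"
    proof (rule lborel_pair.Fubini_integrable)
      show "AE x in lborel. integrable lborel (\<lambda>y. case (x::'a, y) of (x, y) \<Rightarrow> indicator ?A x * norm (g y))"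
        unfolding prod.case by (intro AE_I2 integrable_mult_right integrable_norm g)
      show "integrable lborel (\<lambda>x::'a. LINT y|lborel. norm (case (x, y) of (x, y) \<Rightarrow> indicator ?A x * norm (g y)))"
        unfolding prod.case norm_mult integral_mult_right_zero
        by (intro integrable_mult_left integrable_norm integrable_real_indicator
            emeasure_lborel_box_finite) simp
    qed measurable
    then have "integrable (lborel \<Otimes>\<^sub>M lborel) (\<lambda>z. ?C * (case z of (x::'a, y) \<Rightarrow> indicator ?A x * norm (g y)))"
      by (rule integrable_mult_right)
    then have int: "integrable (lborel \<Otimes>\<^sub>M lborel) (\<lambda>(x, y). ?f n x y)"
    proof (rule Bochner_Integration.integrable_bound)
      show "(\<lambda>(x, y). ?f n x y) \<in> borel_measurable (lborel \<Otimes>\<^sub>M lborel)" by measurable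
      show "AE z in lborel \<Otimes>\<^sub>M lborel. norm (case z of (x, y) \<Rightarrow> ?f n x y)
         \<le> norm (?C * (case z of (x::'a, y) \<Rightarrow> indicator ?A x * norm (g y)))"
      proof (rule AE_I2)
        fix z :: "'a \<times> 'a"
        obtain x y where z: "z = (x, y)" by (cases z)
        have "norm (g y) * \<bar>dilate F n x y\<bar> \<le> norm (g y) * ?C"
          by (intro mult_left_mono dilate_bound[OF L(2)]) auto
        then show "norm (case z of (x, y) \<Rightarrow> ?f n x y)
         \<le> norm (?C * (case z of (x::'a, y) \<Rightarrow> indicator ?A x * norm (g y)))"
          using L(1) by (simp add: z norm_mult abs_mult indicator_def mult_ac)
      qed
    qed
    have "(LINT x|lborel. indicator ?A x *\<^sub>R mollify F g n x) = (LINT x|lborel. LINT y|lborel. ?f n x y)"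
      by (simp add: mollify_def)
    also have "\<dots> = (LINT y|lborel. LINT x|lborel. ?f n x y)"
      using lborel_pair.Fubini_integral[OF int] by simp
    also have "\<dots> = (LINT y|lborel. g y * complex_of_real (w n y))"
    proof (rule Bochner_Integration.integral_cong[OF refl])
      fix y
      have "(LINT x|lborel. ?f n x y) = (LINT x|lborel. g y * complex_of_real (indicator ?A x * dilate F n x y))"
        by (rule Bochner_Integration.integral_cong) (auto simp: indicator_def)
      then show "(LINT x|lborel. ?f n x y) = g y * complex_of_real (w n y)"
        by (simp only: w_def integral_mult_right_zero integral_complex_of_real)
    qed
    finally show ?thesis .
  qed
  have lim: "(\<lambda>n. w n y) \<longlonglongrightarrow> indicator ?A y" if y: "y \<notin> cbox a b - box a b" for y
  proof -
    define U where "U = (if y \<in> ?A then ?A else - cbox a b)"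
    have "open U" "y \<in> U" using y by (auto simp: U_def)
    then obtain e where e: "e > 0" "ball y e \<subseteq> U" by (rule openE)
    have "(1/2::real) < 1" by simp
    from real_arch_pow_inv[OF e(1) this] obtain N where N: "(1/2::real) ^ N < e" by blast
    have "w n y = indicator ?A y" if "n \<ge> N" for n
    proof -
      have le: "(1/2::real) ^ n \<le> (1/2) ^ N" using that by (intro power_decreasing) auto
      have small: "dilate F n x y = 0" if "x \<notin> ball y e" for x
      proof (rule dilate_eq_0[OF F(2)])
        show "(1/2) ^ n \<le> dist x y"
          using le N that by (simp only: mem_ball not_less dist_commute)
      qed
      have eq: "indicator ?A x * dilate F n x y = indicator ?A y * dilate F n x y" for x
      proof (cases "x \<in> ball y e")
        case True
        then have "x \<in> U" using e by blast
        then show ?thesis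
          using box_subset_cbox[of a b] by (auto simp: indicator_def U_def split: if_splits)
      qed (simp add: small)
      have "w n y = (LINT x|lborel. indicator ?A y * dilate F n x y)" 
        unfolding w_def by (rule Bochner_Integration.integral_cong[OF refl eq])
      then show ?thesis using integral_dilate[OF F(1), of n y] one by simp
    qed
    then show ?thesis by (intro tendsto_eventually eventually_sequentiallyI)
  qed
  have "cbox a b - box a b \<in> null_sets lborel"
  proof -
    have "emeasure lborel (cbox a b - box a b) = emeasure lborel (cbox a b) - emeasure lborel (box a b)"
      by (rule emeasure_Diff) (auto simp: box_subset_cbox emeasure_lborel_box_eq)
    then show ?thesis
      by (intro null_setsI) (auto simp: emeasure_lborel_box_eq emeasure_lborel_cbox_eq)
  qed
  then have AE: "AE y in lborel. y \<notin> cbox a b - box a b" by (rule AE_not_in)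
  have wm: "w n \<in> borel_measurable borel" for n unfolding w_def by measurable
  have "(\<lambda>n. LINT y|lborel. g y * complex_of_real (w n y))
      \<longlonglongrightarrow> (LINT y|lborel. g y * complex_of_real (indicator ?A y))"
  proof (rule integral_dominated_convergence[where w = "\<lambda>y. norm (g y)"])
    show "AE y in lborel. (\<lambda>n. g y * complex_of_real (w n y)) \<longlonglongrightarrow> g y * complex_of_real (indicator ?A y)"
      using AE by eventually_elim (intro tendsto_mult tendsto_const tendsto_of_real lim)
    show "AE y in lborel. norm (g y * complex_of_real (w n y)) \<le> norm (g y)" for n
      using w_bound[of n] by (intro AE_I2) (simp add: norm_mult mult_left_le)
    show "(\<lambda>y. g y * complex_of_real (w n y)) \<in> borel_measurable lborel" for n
      using wm[of n] by measurable
  qed (use g in auto)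
  moreover have "g y * complex_of_real (indicator ?A y) = indicator ?A y *\<^sub>R g y" for y
    by (simp add: indicator_def)
  ultimately show ?thesis by (simp add: swap)
qed

text \<open>The sets over which \<open>G\<close> has integral \<open>0\<close> form a Dynkin system containing the boxes, hence
  include all Borel sets, in particular those where the real or imaginary part has a fixed sign.\<close>

lemma AE_zero_if_box_integrals_zero:
  fixes G :: "'a::euclidean_space \<Rightarrow> complex"
  assumes G: "integrable lborel G" and 0: "(LINT x|lborel. G x) = 0"
    and box: "\<And>a b. (LINT x|lborel. indicator (box a b) x *\<^sub>R G x) = 0"
  shows "AE x in lborel. G x = 0"
proof -
  have Gm [measurable]: "G \<in> borel_measurable borel" using borel_measurable_integrable[OF G] by simp
  have int: "integrable lborel (\<lambda>x. indicator A x *\<^sub>R G x)" if "A \<in> sets borel" for A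
    using integrable_mult_indicator[OF _ G, of A] that by simp
  have zero: "(LINT x|lborel. indicator A x *\<^sub>R G x) = 0" if A: "A \<in> sets borel" for A
  proof -
    have "Int_stable (range (\<lambda>(a, b). box a b :: 'a set))"
      by (auto simp: Int_stable_def box_Int_box)
    moreover have "(range (\<lambda>(a, b). box a b :: 'a set)) \<subseteq> Pow UNIV" by auto
    moreover have "A \<in> sigma_sets UNIV (range (\<lambda>(a, b). box a b))"
       using A unfolding borel_eq_box by simp
    ultimately show ?thesis
    proof (induction rule: sigma_sets_induct_disjoint)
      case (basic A) then show ?case using box by auto
    next
      case empty then show ?case by simp
    next
      case (compl A)
      then have [measurable]: "A \<in> sets borel" by (simp add: borel_eq_box)
      have "(LINT x|lborel. indicator (UNIV - A) x *\<^sub>R G x)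
          = (LINT x|lborel. G x - indicator A x *\<^sub>R G x)"
        by (rule Bochner_Integration.integral_cong) (auto simp: indicator_def)
      also have "\<dots> = 0"
        using compl(2) 0 by (subst Bochner_Integration.integral_diff[OF G int]) simp_all
      finally show ?case .
    next
      case (union F)
      then have F: "\<And>i. F i \<in> sets borel" by (simp add: borel_eq_box subset_eq)
      then have "(LINT x:(\<Union>i. F i)|lborel. G x) = (\<Sum>i. LINT x:F i|lborel. G x)"
        using union(1) int[of "\<Union>i. F i"]
        by (intro lebesgue_integral_countable_add)
          (auto simp: set_integrable_def disjoint_family_on_def)
      then show ?case using union.IH by (simp add: set_lebesgue_integral_def)
    qed
  qed
  have part: "AE x in lborel. h x = 0"
    if h: "integrable lborel h" and hz: "\<And>A. A \<in> sets borel \<Longrightarrow> (LINT x|lborel. indicator A x *\<^sub>R h x) = 0"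
    for h :: "'a \<Rightarrow> real"
  proof -
    have [measurable]: "h \<in> borel_measurable borel" using borel_measurable_integrable[OF h] by simp
    let ?P = "{x. h x > 0}" and ?N = "{x. h x < 0}"
    have "AE x in lborel. indicator ?P x *\<^sub>R h x = 0"
      using hz[of ?P] integrable_mult_indicator[OF _ h, of ?P]
      by (subst integral_nonneg_eq_0_iff_AE[symmetric]) (auto simp: indicator_def)
    moreover have "AE x in lborel. - (indicator ?N x *\<^sub>R h x) = 0"
      using hz[of ?N] integrable_mult_indicator[OF _ h, of ?N]
      by (subst integral_nonneg_eq_0_iff_AE[symmetric]) (auto simp: indicator_def)
    ultimately show ?thesis
      by eventually_elim (auto simp: indicator_def split: if_splits)
  qed
  have "AE x in lborel. Re (G x) = 0"
    using G zero[THEN arg_cong[of _ _ Re]] int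
    by (intro part) (auto simp flip: integral_Re)
  moreover have "AE x in lborel. Im (G x) = 0"
    using G zero[THEN arg_cong[of _ _ Im]] int
    by (intro part) (auto simp flip: integral_Im)
  ultimately show ?thesis by eventually_elim (simp add: complex_eq_iff)
qed

section \<open>Interior regularity\<close>

lemma geometric_increments:
  fixes V :: "nat \<Rightarrow> 'b::banach"
  assumes step: "\<And>n. n \<ge> N \<Longrightarrow> norm (V (Suc n) - V n) \<le> C * q ^ n"
    and q: "0 \<le> q" "q < 1" and C: "C \<ge> 0"
  shows "convergent V" "n \<ge> N \<Longrightarrow> norm (V n - V N) \<le> C / (1 - q)"
proof -
  have "summable (\<lambda>n. V (Suc n) - V n)"
  proof (rule summable_comparison_test'[where N = N])
    show "summable (\<lambda>n. C * q ^ n)" using q by (intro summable_mult summable_geometric) simp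
    show "norm (V (Suc n) - V n) \<le> C * q ^ n" if "n \<ge> N" for n using step[OF that] .
  qed
  then have "convergent (\<lambda>n. \<Sum>i<n. V (Suc i) - V i)"
    by (simp add: summable_iff_convergent)
  then have "convergent (\<lambda>n. V n - V 0)" by (simp add: sum_lessThan_telescope)
  then show "convergent V" using convergent_add_const_right_iff[of V "- V 0"] by simp
next
  assume n: "n \<ge> N"
  have "norm (V (N + m) - V N) \<le> C * (1 - q ^ m) / (1 - q)" for m
  proof (induction m)
    case (Suc m)
    have "norm (V (N + Suc m) - V N) \<le> norm (V (Suc (N + m)) - V (N + m)) + norm (V (N + m) - V N)"
      using norm_triangle_ineq[of "V (Suc (N + m)) - V (N + m)" "V (N + m) - V N"] by simp
    also have "norm (V (Suc (N + m)) - V (N + m)) \<le> C * q ^ m"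
    proof -
      have "C * q ^ (N + m) \<le> C * q ^ m"
        using q C by (intro mult_left_mono power_decreasing) auto
      with step[of "N + m"] show ?thesis by simp
    qed
    also note Suc
    also have "C * q ^ m + C * (1 - q ^ m) / (1 - q) = C * (1 - q ^ Suc m) / (1 - q)"
      using q by (simp add: field_simps)
    finally show ?case by simp
  qed simp
  from this[of "n - N"] n have "norm (V n - V N) \<le> C * (1 - q ^ (n - N)) / (1 - q)" by simp
  also have "\<dots> \<le> C * 1 / (1 - q)"
    using q C by (intro divide_right_mono mult_left_mono) auto
  finally show "norm (V n - V N) \<le> C / (1 - q)" by simp
qed

text \<open>On a box inside \<open>S\<close> the integrals of the mollifications tend to those of \<open>W\<close> by dominated
  convergence, and to those of \<open>g\<close> because the kernels approximate the identity.\<close>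

lemma mollify_limit_AE:
  fixes g :: "'a::euclidean_space \<Rightarrow> complex"
  assumes g: "integrable lborel g" and F: "smooth_real F" "\<And>s. s \<ge> 1 \<Longrightarrow> F s = 0" "\<And>s. F s \<ge> 0"
    and one: "(LINT x|lborel. F ((norm (x::'a))\<^sup>2)) = 1"
    and S: "open S"
    and lim: "\<And>x. x \<in> S \<Longrightarrow> (\<lambda>n. mollify F g n x) \<longlonglongrightarrow> W x"
    and bound: "\<And>n x. n \<ge> N \<Longrightarrow> x \<in> S \<Longrightarrow> norm (mollify F g n x) \<le> C"
  shows "AE x in lborel. x \<in> S \<longrightarrow> W x = g x"
proof -
  have gm [measurable]: "g \<in> borel_measurable borel" using borel_measurable_integrable[OF g] by simp
  note [measurable] = mollify_measurable[OF gm F(1)]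
  have box: "AE x in lborel. x \<in> box a b \<longrightarrow> W x = g x" if ab: "box a b \<subseteq> S" for a b
  proof -
    let ?V = "\<lambda>n x. indicator (box a b) x *\<^sub>R mollify F g (n + N) x"
    let ?W = "\<lambda>x. indicator (box a b) x *\<^sub>R W x"
    have lim': "(\<lambda>n. ?V n x) \<longlonglongrightarrow> ?W x" for x
      using lim[of x, THEN LIMSEQ_ignore_initial_segment] ab by (cases "x \<in> box a b") auto
    have Vm: "?V n \<in> borel_measurable borel" for n by measurable
    have Wm [measurable]: "?W \<in> borel_measurable borel"
      by (rule borel_measurable_LIMSEQ_metric[OF Vm lim'])
    have Cint: "integrable lborel (\<lambda>x. indicator (box a b) x * C)"
      using emeasure_lborel_box_finite[of a b] by simp
    have Vb: "norm (?V n x) \<le> indicator (box a b) x * C" for n x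
      using bound[of "n + N" x] ab by (auto simp: indicator_def)
    have Wint: "integrable lborel ?W"
    proof (rule integrable_dominated_convergence[where s = ?V, OF _ _ Cint])
      show "AE x in lborel. (\<lambda>n. ?V n x) \<longlonglongrightarrow> ?W x" by (intro AE_I2 lim')
      show "AE x in lborel. norm (?V n x) \<le> indicator (box a b) x * C" for n by (intro AE_I2 Vb)
    qed (use Vm Wm in simp_all)
    have gint: "integrable lborel (\<lambda>x. indicator (box a b) x *\<^sub>R g x)"
      by (rule integrable_mult_indicator[OF _ g]) simp
    let ?G = "\<lambda>x. ?W x - indicator (box a b) x *\<^sub>R g x"
    have zero: "(LINT x|lborel. indicator (box c d) x *\<^sub>R ?G x) = 0" for c d
    proof -
      obtain c' d' where cd: "box c d \<inter> box a b = box c' d'" by (rule that[OF box_Int_box])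
      have ind: "indicator (box c d) x *\<^sub>R indicator (box a b) x *\<^sub>R h = indicator (box c' d') x *\<^sub>R h"
        for x and h :: complex
        unfolding cd[symmetric] by (simp add: indicator_inter_arith)
      have "(\<lambda>n. LINT x|lborel. indicator (box c' d') x *\<^sub>R mollify F g (n + N) x)
          \<longlonglongrightarrow> (LINT x|lborel. indicator (box c' d') x *\<^sub>R g x)"
        using LIMSEQ_ignore_initial_segment[OF mollify_box_tendsto[OF g F one]] .
      moreover have "(\<lambda>n. LINT x|lborel. indicator (box c d) x *\<^sub>R ?V n x)
          \<longlonglongrightarrow> (LINT x|lborel. indicator (box c d) x *\<^sub>R ?W x)"
      proof (rule integral_dominated_convergence[OF _ _ Cint])
        show "AE x in lborel. norm (indicator (box c d) x *\<^sub>R ?V n x) \<le> indicator (box a b) x * C" for n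
          by (intro AE_I2 order_trans[OF _ Vb[where n = n]]) (simp add: indicator_def)
        show "AE x in lborel. (\<lambda>n. indicator (box c d) x *\<^sub>R ?V n x) \<longlonglongrightarrow> indicator (box c d) x *\<^sub>R ?W x"
          by (intro AE_I2 tendsto_scaleR tendsto_const lim')
      qed (use Wm Vm in measurable)
      ultimately have "(LINT x|lborel. indicator (box c d) x *\<^sub>R ?W x)
          = (LINT x|lborel. indicator (box c' d') x *\<^sub>R g x)"
        unfolding ind by (rule LIMSEQ_unique[rotated])
      moreover have "integrable lborel (\<lambda>x. indicator (box c d) x *\<^sub>R ?W x)"
        "integrable lborel (\<lambda>x. indicator (box c d) x *\<^sub>R indicator (box a b) x *\<^sub>R g x)"
        by (intro integrable_mult_indicator Wint gint; simp)+
      ultimately show ?thesis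
        by (simp only: scaleR_diff_right ind Bochner_Integration.integral_diff diff_self)
    qed
    have "(LINT x|lborel. ?G x) = (LINT x|lborel. indicator (box a b) x *\<^sub>R ?G x)"
      by (rule Bochner_Integration.integral_cong) (auto simp: indicator_def)
    then have "AE x in lborel. ?G x = 0"
      by (intro AE_zero_if_box_integrals_zero zero Bochner_Integration.integrable_diff Wint gint)
         (simp only: zero)
    then show ?thesis by eventually_elim (auto simp: indicator_def)
  qed
  obtain \<D> where \<D>: "countable \<D>" "\<D> \<subseteq> Pow S" "\<And>X. X \<in> \<D> \<Longrightarrow> \<exists>a b. X = box a b" "\<Union>\<D> = S"
    by (rule open_countable_Union_open_box[OF S]) (rule that)
  have "AE x in lborel. \<forall>X\<in>\<D>. x \<in> X \<longrightarrow> W x = g x"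
    unfolding AE_ball_countable[OF \<D>(1)]
  proof
    fix X assume "X \<in> \<D>"
    with \<D>(2,3) obtain a b where "X = box a b" "box a b \<subseteq> S" by blast
    with box show "AE x in lborel. x \<in> X \<longrightarrow> W x = g x" by simp
  qed
  then show ?thesis
    by eventually_elim (use \<D>(4) in blast)
qed

text \<open>Instead of taking a square root of \<open>\<integral>|g|\<^sup>2\<close>, the product \<open>|g| |F\<^sub>n|\<close> is split with a weight
  that depends on \<open>n\<close>. The squared \<open>L\<^sup>2\<close> norm of \<open>F\<^sub>n / 4\<^sup>n\<close> is of order \<open>2\<^sup>n\<^sup>d / 16\<^sup>n\<close>, which
  is at most \<open>2\<^sup>-\<^sup>n\<close> because \<open>d \<le> 3\<close>.\<close>

lemma mollify_bound_L2:
  fixes g :: "'a::euclidean_space \<Rightarrow> complex"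
  assumes g: "integrable lborel g" "integrable lborel (\<lambda>x. (cmod (g x))\<^sup>2)"
    and F: "smooth_real F" "\<And>s. s \<ge> 1 \<Longrightarrow> F s = 0" "\<And>s. s \<ge> 0 \<Longrightarrow> \<bar>F s\<bar> \<le> L"
    and dim: "DIM('a) \<le> 3"
  shows "norm (mollify F g n x) / 4 ^ n
      \<le> ((LINT y|lborel. (cmod (g y))\<^sup>2) + L\<^sup>2 * unit_ball_vol DIM('a)) * (3/4) ^ n"
proof -
  let ?D = "DIM('a)" and ?B = "cball x ((1/2) ^ n)"
  let ?c = "2 ^ (n * DIM('a)) * L / 4 ^ n"
  \<comment> \<open>Any weight \<open>q\<^sup>n\<close> with \<open>1/2 \<le> q\<^sup>2\<close> and \<open>q < 1\<close> would do.\<close>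
  let ?l = "(3/4) ^ n :: real"
  let ?h = "\<lambda>y. ?l * (cmod (g y))\<^sup>2 + indicator ?B y * (?c\<^sup>2 / ?l)"
  have fin: "emeasure lborel ?B < \<infinity>" by (intro emeasure_bounded_finite bounded_cball)
  have int: "integrable lborel ?h" using g fin by simp
  have pt: "cmod (g y * complex_of_real (dilate F n x y)) / 4 ^ n \<le> ?h y" for y
  proof -
    define A where "A = cmod (g y)"
    define K where "K = \<bar>dilate F n x y\<bar> / 4 ^ n"
    have "K \<le> indicator ?B y * ?c"
    proof (cases "y \<in> ?B")
      case True
      then show ?thesis using dilate_bound[OF F(3), where x = x and y = y and n = n]
        by (simp add: K_def divide_right_mono)
    next
      case False
      then show ?thesis using dilate_eq_0[OF F(2), where x = x and y = y and n = n]
        by (simp add: K_def)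
    qed
    moreover have "K \<ge> 0" by (simp add: K_def)
    ultimately have "K\<^sup>2 \<le> (indicator ?B y * ?c)\<^sup>2" by (rule power_mono)
    then have K2: "K\<^sup>2 \<le> indicator ?B y * ?c\<^sup>2" by (auto simp: indicator_def split: if_splits)
    have "0 \<le> (?l * A - K)\<^sup>2 + (?l * A)\<^sup>2 + K\<^sup>2" by simp
    then have "?l * (A * K) \<le> ?l * (?l * A\<^sup>2) + K\<^sup>2"
      by (simp add: power2_eq_square algebra_simps)
    then have "A * K \<le> ?l * A\<^sup>2 + K\<^sup>2 / ?l" by (simp add: field_simps)
    also have "K\<^sup>2 / ?l \<le> indicator ?B y * ?c\<^sup>2 / ?l" using K2 by (intro divide_right_mono) auto
    finally show ?thesis by (simp add: A_def K_def norm_mult)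
  qed
  have "norm (mollify F g n x) / 4 ^ n \<le> (LINT y|lborel. cmod (g y * complex_of_real (dilate F n x y))) / 4 ^ n"
    unfolding mollify_def by (intro divide_right_mono integral_norm_bound) auto
  also have "\<dots> = (LINT y|lborel. cmod (g y * complex_of_real (dilate F n x y)) / 4 ^ n)" by simp
  also have "\<dots> \<le> (LINT y|lborel. ?h y)"
    using integrable_mult_dilate[OF g(1) F(1,3)] pt by (intro integral_mono int) auto
  also have "\<dots> = ?l * (LINT y|lborel. (cmod (g y))\<^sup>2) + measure lborel ?B * (?c\<^sup>2 / ?l)"
    using g fin by simp
  also have "measure lborel ?B = unit_ball_vol ?D * ((1/2) ^ n) ^ ?D"
    by (simp add: content_cball)
  also have "\<dots> * (?c\<^sup>2 / ?l) \<le> L\<^sup>2 * unit_ball_vol ?D * ?l"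
  proof -
    have "((1/2) ^ n) ^ ?D * 2 ^ (n * ?D) = (1::real)"
      by (simp add: power_mult power_one_over)
    then have "((1/2) ^ n) ^ ?D * (2 ^ (n * ?D))\<^sup>2 = (2 ^ (n * ?D) :: real)"
      by (simp add: power2_eq_square flip: mult.assoc)
    also have "\<dots> \<le> 2 ^ (3 * n)" using dim by (intro power_increasing) (auto simp: mult.commute)
    finally have "((1/2) ^ n) ^ ?D * (2 ^ (n * ?D))\<^sup>2 \<le> (8::real) ^ n" by (simp add: power_mult)
    moreover have "(8::real) ^ n \<le> ?l * ?l * (4 ^ n)\<^sup>2"
      by (simp add: power2_eq_square flip: power_mult_distrib) (intro power_mono; simp)
    ultimately have "((1/2) ^ n) ^ ?D * (2 ^ (n * ?D))\<^sup>2 \<le> ?l * ?l * (4 ^ n)\<^sup>2" by (rule order_trans)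
    moreover have "X / Q / l \<le> l" if "X \<le> l * l * Q" "l > 0" "Q > 0" for X Q l :: real
      using that by (simp add: field_simps)
    ultimately have "((1/2) ^ n) ^ ?D * (2 ^ (n * ?D))\<^sup>2 / (4 ^ n)\<^sup>2 / ?l \<le> ?l" by simp
    then have "(L\<^sup>2 * unit_ball_vol ?D) * (((1/2) ^ n) ^ ?D * (2 ^ (n * ?D))\<^sup>2 / (4 ^ n)\<^sup>2 / ?l)
        \<le> (L\<^sup>2 * unit_ball_vol ?D) * ?l"
      by (intro mult_left_mono) auto
    then show ?thesis by (simp add: power_mult_distrib power_divide mult_ac)
  qed
  finally show ?thesis by (simp add: algebra_simps)
qed

text \<open>The difference of the two kernels is at most \<open>2\<^sup>n\<^sup>d L 2\<^sup>n |x - x'|\<close> and lives on two balls of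
  volume of order \<open>2\<^sup>-\<^sup>n\<^sup>d\<close>; dividing by \<open>4\<^sup>n\<close> leaves \<open>2\<^sup>-\<^sup>n |x - x'|\<close>.\<close>

lemma mollify_diff_bound_L_infinity:
  fixes g :: "'a::euclidean_space \<Rightarrow> complex"
  assumes g: "integrable lborel g"
    and F: "smooth_real F" "\<And>s. s \<ge> 1 \<Longrightarrow> F s = 0" "\<And>s. s \<ge> 0 \<Longrightarrow> \<bar>F s\<bar> \<le> L"
    and lip: "\<And>x y :: 'a. \<bar>F ((norm x)\<^sup>2) - F ((norm y)\<^sup>2)\<bar> \<le> L * norm (x - y)"
    and M: "AE y in lborel. y \<in> cball x ((1/2) ^ n) \<union> cball x' ((1/2) ^ n) \<longrightarrow> cmod (g y) \<le> M"
    and L0: "L \<ge> 0" and M0: "M \<ge> 0"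
  shows "norm (mollify F g n x - mollify F g n x') / 4 ^ n
      \<le> 2 * unit_ball_vol DIM('a) * M * L * dist x x' * (1/2) ^ n"
proof -
  let ?D = "DIM('a)" and ?B = "\<lambda>x. cball x ((1/2) ^ n) :: 'a set"
  let ?c = "M * (2 ^ (n * ?D) * L * 2 ^ n * dist x x')"
  let ?h = "\<lambda>y. ?c * indicator (?B x) y + ?c * indicator (?B x') y"
  let ?d = "\<lambda>y. g y * complex_of_real (dilate F n x y) - g y * complex_of_real (dilate F n x' y)"
  have fin: "emeasure lborel (?B x) < \<infinity>" for x by (intro emeasure_bounded_finite bounded_cball)
  note int = integrable_mult_dilate[OF g F(1,3)]
  have c0: "?c \<ge> 0" using L0 M0 by simp
  have "norm (mollify F g n x - mollify F g n x') = norm (LINT y|lborel. ?d y)"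
    unfolding mollify_def using int by (subst Bochner_Integration.integral_diff) auto
  also have "\<dots> \<le> (LINT y|lborel. norm (?d y))" by (rule integral_norm_bound)
  also have "\<dots> \<le> (LINT y|lborel. ?h y)"
  proof (rule integral_mono_AE)
    show "integrable lborel (\<lambda>y. norm (?d y))"
      by (intro integrable_norm Bochner_Integration.integrable_diff int)
    show "integrable lborel ?h" using fin by (intro Bochner_Integration.integrable_add integrable_mult_right) auto
    show "AE y in lborel. norm (?d y) \<le> ?h y"
      using M
    proof eventually_elim
      case (elim y)
      show ?case
      proof (cases "y \<in> ?B x \<union> ?B x'")
        case True
        have "?d y = g y * complex_of_real (dilate F n x y - dilate F n x' y)"
          by (simp add: algebra_simps)
        then have "norm (?d y) = cmod (g y) * \<bar>dilate F n x y - dilate F n x' y\<bar>"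
          by (simp only: norm_mult norm_of_real)
        also have "\<dots> \<le> ?c"
          using elim True M0 by (intro mult_mono dilate_lipschitz lip) auto
        also have "\<dots> \<le> ?h y" using True c0 by (auto simp: indicator_def)
        finally show ?thesis .
      next
        case False
        then have "dilate F n x y = 0" "dilate F n x' y = 0"
          by (auto intro!: dilate_eq_0 F)
        then show ?thesis using c0 by simp
      qed
    qed
  qed
  also have "\<dots> = ?c * measure lborel (?B x) + ?c * measure lborel (?B x')"
    using fin by simp
  also have "\<dots> = 2 * ?c * (unit_ball_vol ?D * ((1/2) ^ n) ^ ?D)"
    by (simp add: content_cball)
  also have "\<dots> = 2 * unit_ball_vol ?D * M * L * dist x x' * 2 ^ n * (2 ^ (n * ?D) * ((1/2) ^ n) ^ ?D)"
    by (simp add: mult_ac)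
  also have "2 ^ (n * ?D) * ((1/2) ^ n) ^ ?D = (1::real)"
    by (simp add: power_mult power_one_over)
  finally have "norm (mollify F g n x - mollify F g n x') / 4 ^ n
     \<le> 2 * unit_ball_vol ?D * M * L * dist x x' * 2 ^ n / 4 ^ n"
    by (simp add: divide_right_mono)
  also have "2 ^ n / 4 ^ n = (1/2 :: real) ^ n"
    by (simp flip: power_divide)
  then have "2 * unit_ball_vol ?D * M * L * dist x x' * 2 ^ n / 4 ^ n =
     2 * unit_ball_vol ?D * M * L * dist x x' * (1/2) ^ n"
    by (simp only: times_divide_eq_right[symmetric])
  finally show ?thesis .
qed

text \<open>The equation is tested with the function \<open>y \<mapsto> 2\<^sup>n\<^sup>d 4\<^sup>-\<^sup>n T(4\<^sup>n |y - x|\<^sup>2)\<close>, supported in the ball of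
  radius \<open>2\<^sup>-\<^sup>n\<close> about \<open>x\<close>: by the relation between \<open>T\<close> and \<open>F\<close> its Laplacian is the difference
  of two consecutive kernels.\<close>

lemma mollify_step:
  fixes g :: "'a::euclidean_space \<Rightarrow> complex" and T T' T'' F :: "real \<Rightarrow> real"
  assumes g: "integrable lborel g"
    and T: "smooth_real T" "\<And>s. (T has_real_derivative T' s) (at s)"
      "\<And>s. (T' has_real_derivative T'' s) (at s)" "\<And>s. s \<ge> 1 \<Longrightarrow> T s = 0"
    and F: "smooth_real F" "\<And>s. s \<ge> 1 \<Longrightarrow> F s = 0"
    and TF: "\<And>s. 4 * s * T'' s + 2 * real DIM('a) * T' s = 2 ^ DIM('a) * F (4 * s) - F s"
    and weak: "\<And>\<phi>. \<phi> \<in> test_functions \<Omega> \<Longrightarrow>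
      (LINT y|lborel. g y * laplacian \<phi> y) = - complex_of_real \<kappa> * (LINT y|lborel. g y * \<phi> y)"
    and sub: "cball x ((1/2) ^ n) \<subseteq> \<Omega>"
  shows "mollify F g (Suc n) x - mollify F g n x = - complex_of_real \<kappa> * (mollify T g n x / 4 ^ n)"
proof -
  obtain L where L: "\<And>s. s \<ge> 0 \<Longrightarrow> \<bar>F s\<bar> \<le> L" using radial_bounds[OF F] by metis
  define c :: real where "c = 2 ^ (n * DIM('a)) / 4 ^ n"
  let ?\<phi> = "\<lambda>y. complex_of_real (c * T (4 ^ n * (norm (y - x))\<^sup>2))"
  have four: "(4::real) ^ n * ((1/2) ^ n)\<^sup>2 = 1"
    by (simp add: power_mult[symmetric] mult.commute[of n] power_mult power_one_over)
  have "?\<phi> \<in> test_functions \<Omega>"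
    by (rule radial_test_function[of "\<lambda>s. c * T s", OF _ _ _ four sub])
      (auto intro!: smooth_real_intros T simp: T(4))
  note eq = weak[OF this]
  have lap: "laplacian ?\<phi> y = complex_of_real (dilate F (Suc n) x y) - complex_of_real (dilate F n x y)" for y
  proof -
    let ?s = "4 ^ n * (norm (y - x))\<^sup>2"
    have D: "((\<lambda>s. c * T s) has_real_derivative c * T' s) (at s)"
      "((\<lambda>s. c * T' s) has_real_derivative c * T'' s) (at s)" for s
      using DERIV_cmult[OF T(2)] DERIV_cmult[OF T(3)] by auto
    have "laplacian ?\<phi> y = complex_of_real (4 ^ n * (4 * ?s * (c * T'' ?s) + 2 * real DIM('a) * (c * T' ?s)))"
      by (rule laplacian_radial[OF D])
    also have "4 ^ n * (4 * ?s * (c * T'' ?s) + 2 * real DIM('a) * (c * T' ?s))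
        = 4 ^ n * c * (4 * ?s * T'' ?s + 2 * real DIM('a) * T' ?s)"
      by (simp only: distrib_left mult_ac)
    also have "\<dots> = 2 ^ (n * DIM('a)) * (2 ^ DIM('a) * F (4 * ?s) - F ?s)"
      unfolding TF c_def by simp
    also have "\<dots> = dilate F (Suc n) x y - dilate F n x y"
      by (simp add: dilate_def power_add algebra_simps)
    finally show ?thesis by simp
  qed
  have "mollify F g (Suc n) x - mollify F g n x = (LINT y|lborel. g y * laplacian ?\<phi> y)"
    unfolding lap right_diff_distrib mollify_def
    by (rule Bochner_Integration.integral_diff[symmetric]; rule integrable_mult_dilate[OF g F(1) L])
  also have "\<dots> = - complex_of_real \<kappa> * (LINT y|lborel. g y * ?\<phi> y)" by (rule eq)
  also have "(LINT y|lborel. g y * ?\<phi> y) = (LINT y|lborel. g y * complex_of_real (dilate T n x y) / 4 ^ n)"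
    by (rule Bochner_Integration.integral_cong) (simp_all add: dilate_def c_def)
  also have "\<dots> = mollify T g n x / 4 ^ n" by (simp add: mollify_def)
  finally show ?thesis .
qed

lemma radial_integral_pos:
  assumes F: "smooth_real F" "\<And>s. s \<ge> 1 \<Longrightarrow> F s = 0" "\<And>s. F s \<ge> 0" "F (1/2) > 0"
  shows "(LINT x|lborel. F ((norm (x::'a::euclidean_space))\<^sup>2)) > 0"
proof -
  let ?f = "\<lambda>x::'a. F ((norm x)\<^sup>2)"
  have cont: "continuous_on UNIV ?f"
    using continuous_on_compose2[of UNIV F UNIV "\<lambda>x::'a. (norm x)\<^sup>2"] smooth_real_continuous[OF F(1)]
    by (simp add: continuous_on_power continuous_on_norm)
  have "integrable lborel (\<lambda>x. indicator (cball 0 1) x *\<^sub>R ?f x)"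
    by (rule borel_integrable_compact) (auto intro: continuous_on_subset[OF cont])
  also have "(\<lambda>x. indicator (cball 0 1) x *\<^sub>R ?f x) = ?f"
    using F(2) by (auto simp: indicator_def fun_eq_iff)
  finally have int: "integrable lborel ?f" .
  have "(LINT x|lborel. ?f x) \<noteq> 0"
  proof
    assume "(LINT x|lborel. ?f x) = 0"
    then have "AE x in lborel. ?f x = 0"
      by (subst (asm) integral_nonneg_eq_0_iff_AE[OF int]) (simp_all add: F(3))
    then have AE: "AE x in lebesgue. x \<in> {x. ?f x = 0}" by (simp add: AE_completion)
    have "closed {x. ?f x = 0}"
      by (rule closed_Collect_eq) (use cont in auto)
    from mem_closed_if_AE_lebesgue[OF this AE] have z: "?f x = 0" for x by simp
    obtain b :: 'a where "b \<in> Basis" using nonempty_Basis by blast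
    then have sq: "(norm (sqrt (1/2) *\<^sub>R b))\<^sup>2 = 1/2" by simp
    show False using z[of "sqrt (1/2) *\<^sub>R b", unfolded sq] F(4) by simp
  qed
  moreover have "(LINT x|lborel. ?f x) \<ge> 0"
    by (rule Bochner_Integration.integral_nonneg) (simp add: F(3))
  ultimately show ?thesis by simp
qed

text \<open>The bound in \<open>L\<^sup>2\<close> is used on a ball about \<open>p\<close> to obtain a bounded limit \<open>W\<close>, which is then
  identified with \<open>g\<close>; on the ball of half the radius, the bound for bounded \<open>g\<close> gives the
  Lipschitz estimate. The limit \<open>W\<close> is the same function for all \<open>p\<close>, so that no local
  representatives have to be glued.\<close>

lemma weak_helmholtz_regularity:
  fixes g :: "'a::euclidean_space \<Rightarrow> complex"
  assumes dim: "DIM('a) \<le> 3" and "open \<Omega>"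
    and g: "integrable lborel g" "integrable lborel (\<lambda>x. (cmod (g x))\<^sup>2)"
    and weak: "\<And>\<phi>. \<phi> \<in> test_functions \<Omega> \<Longrightarrow>
      (LINT y|lborel. g y * laplacian \<phi> y) = - complex_of_real \<kappa> * (LINT y|lborel. g y * \<phi> y)"
  obtains W where "\<And>p. p \<in> \<Omega> \<Longrightarrow> \<exists>r>0. \<exists>L. L-lipschitz_on (ball p r) W \<and> ball p r \<subseteq> \<Omega>
      \<and> (AE x in lborel. x \<in> ball p r \<longrightarrow> W x = g x)"
proof -
  obtain \<theta> \<theta>' \<theta>'' \<eta> :: "real \<Rightarrow> real" where K: "smooth_real \<theta>"
    "\<And>s. (\<theta> has_real_derivative \<theta>' s) (at s)"
    "\<And>s. (\<theta>' has_real_derivative \<theta>'' s) (at s)" "smooth_real \<eta>"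
    "\<And>s. s \<ge> 1 \<Longrightarrow> \<theta> s = 0" "\<And>s. s \<ge> 1 \<Longrightarrow> \<eta> s = 0"
    "\<And>s. \<eta> s \<ge> 0" "\<eta> (1/2) > 0"
    "\<And>s. 4 * s * \<theta>'' s + 2 * real DIM('a) * \<theta>' s = 2 ^ DIM('a) * \<eta> (4 * s) - \<eta> s"
    by (rule radial_kernels_exist[of "DIM('a)"]) (rule that)
  define c where "c = inverse (LINT x|lborel. \<eta> ((norm (x::'a))\<^sup>2))"
  have c: "c > 0" using radial_integral_pos[OF K(4,6,7,8), where 'a='a] by (simp add: c_def)
  define F where "F s = c * \<eta> s" for s
  define T where "T s = c * \<theta> s" for s
  have F: "smooth_real F" "\<And>s. s \<ge> 1 \<Longrightarrow> F s = 0" "\<And>s. F s \<ge> 0"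
    and one: "(LINT x|lborel. F ((norm (x::'a))\<^sup>2)) = 1"
    using K(6,7) c by (auto simp: F_def[abs_def] c_def intro!: smooth_real_intros K)
  have T: "smooth_real T" "\<And>s. s \<ge> 1 \<Longrightarrow> T s = 0"
    using K(5) by (auto simp: T_def[abs_def] intro!: smooth_real_intros K)
  have step: "mollify F g (Suc n) x - mollify F g n x = - complex_of_real \<kappa> * (mollify T g n x / 4 ^ n)"
    if sub: "cball x ((1/2) ^ n) \<subseteq> \<Omega>" for x n
  proof (rule mollify_step[OF g(1) T(1) _ _ T(2) F(1,2) _ weak sub])
    show "(T has_real_derivative c * \<theta>' s) (at s)" "((\<lambda>s. c * \<theta>' s) has_real_derivative c * \<theta>'' s) (at s)" for s
      unfolding T_def[abs_def] by (intro DERIV_cmult K)+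
    show "4 * s * (c * \<theta>'' s) + 2 * real DIM('a) * (c * \<theta>' s) = 2 ^ DIM('a) * F (4 * s) - F s" for s
      using arg_cong[OF K(9)[of s], of "\<lambda>t. c * t"] by (simp add: F_def algebra_simps)
  qed
  obtain LF where LF: "LF \<ge> 0" "\<And>s. s \<ge> 0 \<Longrightarrow> \<bar>F s\<bar> \<le> LF"
    "\<And>x y :: 'a. \<bar>F ((norm x)\<^sup>2) - F ((norm y)\<^sup>2)\<bar> \<le> LF * norm (x - y)"
    using radial_bounds[OF F(1,2)] by metis
  obtain LT where LT: "LT \<ge> 0" "\<And>s. s \<ge> 0 \<Longrightarrow> \<bar>T s\<bar> \<le> LT"
    "\<And>x y :: 'a. \<bar>T ((norm x)\<^sup>2) - T ((norm y)\<^sup>2)\<bar> \<le> LT * norm (x - y)"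
    using radial_bounds[OF T] by metis
  define V where "V = mollify F g"
  define W where "W x = lim (\<lambda>n. V n x)" for x
  define C1 where "C1 = \<bar>\<kappa>\<bar> * ((LINT y|lborel. (cmod (g y))\<^sup>2) + LT\<^sup>2 * unit_ball_vol DIM('a))"
  have C1: "C1 \<ge> 0" unfolding C1_def
    by (intro mult_nonneg_nonneg add_nonneg_nonneg Bochner_Integration.integral_nonneg) auto
  show thesis
  proof (rule that[of W])
    fix p assume "p \<in> \<Omega>"
    obtain R where R: "R > 0" "ball p R \<subseteq> \<Omega>"
      using openE[OF \<open>open \<Omega>\<close> \<open>p \<in> \<Omega>\<close>] by metis
    define r where "r = R / 3"
    have r: "r > 0" using R by (simp add: r_def)
    have "(1/2::real) < 1" by simp
    from real_arch_pow_inv[OF r this] obtain N where N: "(1/2::real) ^ N < r" by blast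
    have small: "(1/2::real) ^ n < r" if "n \<ge> N" for n
    proof -
      have "(1/2::real) ^ n \<le> (1/2) ^ N" using that by (intro power_decreasing) auto
      with N show ?thesis by linarith
    qed
    have near: "cball x ((1/2) ^ n) \<subseteq> ball p (s + r)" if "n \<ge> N" "x \<in> ball p s" for x n s
    proof
      fix y assume "y \<in> cball x ((1/2) ^ n)"
      then show "y \<in> ball p (s + r)"
        using small[OF that(1)] that(2) dist_triangle[of p y x] by simp
    qed
    \<comment> \<open>Three radii: \<open>g\<close> solves the equation on \<open>ball p (3 * r)\<close>, is bounded on
      \<open>ball p (2 * r)\<close>, and is Lipschitz on \<open>ball p r\<close>.\<close>
    let ?S = "ball p (2 * r)"
    have in\<Omega>: "cball x ((1/2) ^ n) \<subseteq> \<Omega>" if "n \<ge> N" "x \<in> ?S" for x n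
      using near[OF that] R by (simp add: r_def) 
    have V1: "norm (V (Suc n) x - V n x) \<le> C1 * (3/4) ^ n" if "n \<ge> N" "x \<in> ?S" for n x
    proof -
      have "norm (V (Suc n) x - V n x) = \<bar>\<kappa>\<bar> * (norm (mollify T g n x) / 4 ^ n)"
        unfolding V_def step[OF in\<Omega>[OF that]] by (simp add: norm_mult norm_divide norm_power)
      also have "\<dots> \<le> \<bar>\<kappa>\<bar> * (((LINT y|lborel. (cmod (g y))\<^sup>2) + LT\<^sup>2 * unit_ball_vol DIM('a)) * (3/4) ^ n)"
        by (intro mult_left_mono mollify_bound_L2 g T LT dim) auto
      finally show ?thesis by (simp only: C1_def mult.assoc)
    qed
    have q: "0 \<le> (3/4::real)" "(3/4::real) < 1" by simp_all
    have conv: "(\<lambda>n. V n x) \<longlonglongrightarrow> W x" if x: "x \<in> ?S" for x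
      using geometric_increments(1)[OF V1[OF _ x] q C1] unfolding W_def by (simp add: convergent_LIMSEQ_iff)
    define M where "M = C1 / (1 - 3/4) + (LINT y|lborel. cmod (g y)) * (2 ^ (N * DIM('a)) * LF)"
    have bound: "norm (V n x) \<le> M" if n: "n \<ge> N" and x: "x \<in> ?S" for n x
    proof -
      have "norm (V N x) \<le> (LINT y|lborel. norm (g y * complex_of_real (dilate F N x y)))"
        unfolding V_def mollify_def by (rule integral_norm_bound)
      also have "\<dots> \<le> (LINT y|lborel. cmod (g y) * (2 ^ (N * DIM('a)) * LF))"
      proof (rule integral_mono)
        show "integrable lborel (\<lambda>y. norm (g y * complex_of_real (dilate F N x y)))"
          by (intro integrable_norm integrable_mult_dilate[OF g(1) F(1) LF(2)])
        show "integrable lborel (\<lambda>y. cmod (g y) * (2 ^ (N * DIM('a)) * LF))"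
          by (intro integrable_mult_left integrable_norm g)
        show "norm (g y * complex_of_real (dilate F N x y)) \<le> cmod (g y) * (2 ^ (N * DIM('a)) * LF)" for y
          unfolding norm_mult norm_of_real by (intro mult_left_mono dilate_bound LF) auto
      qed
      finally have "norm (V N x) \<le> (LINT y|lborel. cmod (g y)) * (2 ^ (N * DIM('a)) * LF)" by simp
      moreover have "norm (V n x - V N x) \<le> C1 / (1 - 3/4)"
        using geometric_increments(2)[OF V1[OF _ x] q C1 n] .
      ultimately show ?thesis
        using norm_triangle_ineq[of "V n x - V N x" "V N x"] by (simp add: M_def)
    qed
    have M0: "M \<ge> 0" using order_trans[OF norm_ge_zero bound[of N p]] r by simp
    have AEW: "AE x in lborel. x \<in> ?S \<longrightarrow> W x = g x"
      by (rule mollify_limit_AE[OF g(1) F one open_ball conv[unfolded V_def] bound[unfolded V_def]])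
    have W_bound: "norm (W x) \<le> M" if x: "x \<in> ?S" for x
      by (rule LIMSEQ_le_const2[OF tendsto_norm[OF conv[OF x]]]) (use bound x in auto)
    have AEM: "AE y in lborel. y \<in> ?S \<longrightarrow> cmod (g y) \<le> M"
      using AEW
    proof eventually_elim
      case (elim y)
      then show ?case using W_bound[of y] by auto
    qed
    define C2 where "C2 = \<bar>\<kappa>\<bar> * (2 * unit_ball_vol DIM('a) * M * LT)"
    have C2: "C2 \<ge> 0" unfolding C2_def using M0 LT by auto
    have V2: "norm ((V (Suc n) x - V (Suc n) x') - (V n x - V n x')) \<le> C2 * dist x x' * (1/2) ^ n"
      if n: "n \<ge> N" and x: "x \<in> ball p r" "x' \<in> ball p r" for n x x'
    proof -
      have sub: "cball x ((1/2) ^ n) \<union> cball x' ((1/2) ^ n) \<subseteq> ?S"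
        unfolding mult_2 by (rule Un_least[OF near[OF n x(1)] near[OF n x(2)]])
      have xS: "x \<in> ?S" "x' \<in> ?S" using x r by auto
      have "(V (Suc n) x - V (Suc n) x') - (V n x - V n x') = (V (Suc n) x - V n x) - (V (Suc n) x' - V n x')"
        by simp
      also have "\<dots> = - complex_of_real \<kappa> * ((mollify T g n x - mollify T g n x') / 4 ^ n)"
        unfolding V_def step[OF in\<Omega>[OF n xS(1)]] step[OF in\<Omega>[OF n xS(2)]]
        by (simp add: diff_divide_distrib right_diff_distrib)
      finally have "norm ((V (Suc n) x - V (Suc n) x') - (V n x - V n x'))
          = \<bar>\<kappa>\<bar> * (norm (mollify T g n x - mollify T g n x') / 4 ^ n)"
        by (simp add: norm_mult norm_divide norm_power)
      also have "\<dots> \<le> \<bar>\<kappa>\<bar> * (2 * unit_ball_vol DIM('a) * M * LT * dist x x' * (1/2) ^ n)"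
      proof (intro mult_left_mono mollify_diff_bound_L_infinity g T LT M0)
        show "AE y in lborel. y \<in> cball x ((1/2) ^ n) \<union> cball x' ((1/2) ^ n) \<longrightarrow> cmod (g y) \<le> M"
          using AEM by eventually_elim (use sub in blast)
      qed auto
      finally show ?thesis by (simp only: C2_def mult.assoc)
    qed
    define L where "L = C2 / (1 - 1/2) + (LINT y|lborel. cmod (g y)) * (2 ^ (N * DIM('a)) * LF * 2 ^ N)"
    have VN: "norm (V N x - V N x') \<le> (LINT y|lborel. cmod (g y)) * (2 ^ (N * DIM('a)) * LF * 2 ^ N) * dist x x'" for x x'
    proof -
      note int = integrable_mult_dilate[OF g(1) F(1) LF(2), where n = N]
      have "norm (V N x - V N x') = norm (LINT y|lborel. g y * complex_of_real (dilate F N x y - dilate F N x' y))"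
        unfolding V_def mollify_def of_real_diff right_diff_distrib
        by (rule arg_cong[where f = norm]) (rule Bochner_Integration.integral_diff[OF int int, symmetric])
      also have "\<dots> \<le> (LINT y|lborel. norm (g y * complex_of_real (dilate F N x y - dilate F N x' y)))"
        by (rule integral_norm_bound)
      also have "\<dots> \<le> (LINT y|lborel. cmod (g y) * (2 ^ (N * DIM('a)) * LF * 2 ^ N * dist x x'))"
      proof (rule integral_mono)
        show "integrable lborel (\<lambda>y. norm (g y * complex_of_real (dilate F N x y - dilate F N x' y)))"
          unfolding of_real_diff right_diff_distrib
          by (intro integrable_norm Bochner_Integration.integrable_diff int)
        show "integrable lborel (\<lambda>y. cmod (g y) * (2 ^ (N * DIM('a)) * LF * 2 ^ N * dist x x'))"
          by (intro integrable_mult_left integrable_norm g)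
        show "norm (g y * complex_of_real (dilate F N x y - dilate F N x' y))
            \<le> cmod (g y) * (2 ^ (N * DIM('a)) * LF * 2 ^ N * dist x x')" for y
          unfolding norm_mult norm_of_real by (intro mult_left_mono dilate_lipschitz LF) auto
      qed
      finally show ?thesis by (simp add: mult.assoc)
    qed
    have "L-lipschitz_on (ball p r) W"
    proof (rule lipschitz_onI)
      show "0 \<le> L" unfolding L_def using C2 LF(1)
        by (intro add_nonneg_nonneg mult_nonneg_nonneg Bochner_Integration.integral_nonneg divide_nonneg_nonneg) auto
      fix x x' assume x: "x \<in> ball p r" "x' \<in> ball p r"
      then have xS: "x \<in> ?S" "x' \<in> ?S" using r by auto
      have q: "0 \<le> (1/2::real)" "(1/2::real) < 1" by simp_all
      have "norm (V n x - V n x') \<le> L * dist x x'" if n: "n \<ge> N" for n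
      proof -
        have "C2 * dist x x' \<ge> 0" using C2 by simp
        from geometric_increments(2)[of N "\<lambda>n. V n x - V n x'", OF V2[OF _ x] q this n]
        have "norm ((V n x - V n x') - (V N x - V N x')) \<le> C2 * dist x x' / (1 - 1/2)" .
        then show ?thesis
          using norm_triangle_ineq[of "(V n x - V n x') - (V N x - V N x')" "V N x - V N x'"] VN[of x x']
          by (simp add: L_def distrib_right)
      qed
      then have "norm (W x - W x') \<le> L * dist x x'"
        by (intro LIMSEQ_le_const2[OF tendsto_norm[OF tendsto_diff[OF conv[OF xS(1)] conv[OF xS(2)]]]]) auto
      then show "dist (W x) (W x') \<le> L * dist x x'" by (simp add: dist_norm)
    qed
    moreover have "AE x in lborel. x \<in> ball p r \<longrightarrow> W x = g x"
      using AEW by eventually_elim (use r in auto)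
    moreover have "ball p r \<subseteq> \<Omega>" using R by (auto simp: r_def)
    ultimately show "\<exists>r>0. \<exists>L. L-lipschitz_on (ball p r) W \<and> ball p r \<subseteq> \<Omega>
      \<and> (AE x in lborel. x \<in> ball p r \<longrightarrow> W x = g x)"
      using r by blast
  qed
qed

section \<open>Regular representatives of Helmholtz solutions\<close>

lemma smooth_imp_continuous: "smooth \<phi> \<Longrightarrow> continuous_on UNIV \<phi>"
  using diff_times.simps(1) unfolding smooth_def by metis

lemma smooth_imp_continuous_laplacian:
  assumes "smooth \<phi>"
  shows "continuous_on UNIV (laplacian \<phi>)"
proof -
  have "diff_times (Suc (Suc 0)) \<phi>" using assms by (simp only: smooth_def)
  then have "continuous_on UNIV (pd b (pd b \<phi>))" if "b \<in> Basis" for b using that by simp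
  then show ?thesis unfolding laplacian_def[abs_def] by (intro continuous_on_sum) simp
qed

lemma borel_representative_complex:
  fixes h :: "'a::euclidean_space \<Rightarrow> complex"
  assumes "h \<in> borel_measurable lebesgue"
  obtains g where "g \<in> borel_measurable borel" "AE x in lebesgue. h x = g x"
proof -
  have part: "\<exists>a. a \<in> borel_measurable borel \<and> (AE x in lborel. l x = a x)"
    if "l \<in> borel_measurable lebesgue" for l :: "'a \<Rightarrow> real"
    using completion_ex_borel_measurable_real[OF that] by auto
  have "(\<lambda>x. Re (h x)) \<in> borel_measurable lebesgue" "(\<lambda>x. Im (h x)) \<in> borel_measurable lebesgue"
    using assms by measurable
  from this[THEN part] obtain a b where ab: "a \<in> borel_measurable borel" "AE x in lborel. Re (h x) = a x"
    "b \<in> borel_measurable borel" "AE x in lborel. Im (h x) = b x"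
    by blast
  show thesis
  proof
    show "(\<lambda>x. Complex (a x) (b x)) \<in> borel_measurable borel"
      using ab(1,3) unfolding Complex_eq by measurable
    show "AE x in lebesgue. h x = Complex (a x) (b x)"
      by (rule AE_completion) (use ab(2,4) in \<open>eventually_elim, simp add: complex_eq_iff\<close>)
  qed
qed

lemma AE_locally:
  assumes "\<And>p. p \<in> \<Omega> \<Longrightarrow> \<exists>r>0. AE x in lborel. x \<in> ball p r \<longrightarrow> P x"
  shows "AE x in lebesgue. x \<in> \<Omega> \<longrightarrow> P x"
proof -
  have "negligible {x \<in> \<Omega>. \<not> P x}"
    unfolding locally_negligible_alt[of "{x \<in> \<Omega>. \<not> P x}"]
  proof
    fix p assume p: "p \<in> {x \<in> \<Omega>. \<not> P x}"
    then obtain r where r: "r > 0" "AE x in lborel. x \<in> ball p r \<longrightarrow> P x" using assms by blast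
    then have "AE x in lebesgue. x \<in> ball p r \<longrightarrow> P x" by (intro AE_completion)
    then obtain N where N: "negligible N" "{x. \<not> (x \<in> ball p r \<longrightarrow> P x)} \<subseteq> N"
      unfolding eventually_ae_filter_negligible by blast
    show "\<exists>U. openin (top_of_set {x \<in> \<Omega>. \<not> P x}) U \<and> p \<in> U \<and> negligible U"
    proof (intro exI conjI)
      show "openin (top_of_set {x \<in> \<Omega>. \<not> P x}) ({x \<in> \<Omega>. \<not> P x} \<inter> ball p r)"
        by (rule openin_open_Int) simp
      show "negligible ({x \<in> \<Omega>. \<not> P x} \<inter> ball p r)"
        by (rule negligible_subset[OF N(1)]) (use N(2) in auto)
    qed (use p r in auto)
  qed
  then show ?thesis unfolding eventually_ae_filter_negligible by (intro exI[of _ "{x \<in> \<Omega>. \<not> P x}"]) auto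
qed

text \<open>The weak equation concerns Lebesgue measurable functions on \<open>\<Omega>\<close>, the mollification argument
  Borel functions on the whole space: \<open>v\<close> is extended by \<open>0\<close> and replaced by a Borel function
  equal to it almost everywhere.\<close>

lemma helmholtz_regular_representative:
  fixes \<Omega> :: "'a::euclidean_space set"
  assumes dim: "DIM('a) \<le> 3" and \<Omega>: "open \<Omega>" "bounded \<Omega>" and v: "helmholtz \<Omega> k v (\<lambda>_. 0)"
  obtains W where "AE x in lebesgue_on \<Omega>. W x = v x"
    "\<And>p. p \<in> \<Omega> \<Longrightarrow> \<exists>r>0. \<exists>L. L-lipschitz_on (ball p r) W \<and> ball p r \<subseteq> \<Omega>"
proof -
  have \<Omega>m: "\<Omega> \<in> sets lebesgue" "\<Omega> \<inter> space lebesgue \<in> sets lebesgue" using \<Omega>(1) by auto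
  have fin: "emeasure lebesgue \<Omega> < \<infinity>"
    using emeasure_bounded_finite[OF \<Omega>(2)] \<Omega>(1) by simp
  have vm: "v \<in> borel_measurable (lebesgue_on \<Omega>)"
    and v2: "integrable (lebesgue_on \<Omega>) (\<lambda>x. (cmod (v x))\<^sup>2)"
    using v by (auto simp: helmholtz_def H1_def L2_def)
  define h where "h x = indicator \<Omega> x *\<^sub>R v x" for x
  have hm: "h \<in> borel_measurable lebesgue"
    using vm unfolding h_def[abs_def] borel_measurable_restrict_space_iff[OF \<Omega>m(2)] .
  obtain g where g: "g \<in> borel_measurable borel" "AE x in lebesgue. h x = g x"
    using borel_representative_complex[OF hm] .
  have gm: "g \<in> borel_measurable lebesgue" using g(1) by (simp add: measurable_completion)
  have h2: "integrable lebesgue (\<lambda>x. (cmod (h x))\<^sup>2)"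
  proof -
    have "(\<lambda>x. (cmod (h x))\<^sup>2) = (\<lambda>x. indicator \<Omega> x *\<^sub>R (cmod (v x))\<^sup>2)"
      by (auto simp: h_def indicator_def)
    then show ?thesis using v2 unfolding integrable_restrict_space[OF \<Omega>m(2)] by simp
  qed
  have h1: "integrable lebesgue h"
  proof (rule Bochner_Integration.integrable_bound)
    show "integrable lebesgue (\<lambda>x. indicator \<Omega> x + (cmod (h x))\<^sup>2)"
      using h2 \<Omega>m(1) fin by (intro Bochner_Integration.integrable_add integrable_real_indicator)
    have "cmod (h x) \<le> indicator \<Omega> x + (cmod (h x))\<^sup>2" for x
    proof (cases "x \<in> \<Omega>")
      case True
      have "0 \<le> (cmod (h x) - 1/2)\<^sup>2" by simp
      then show ?thesis using True by (simp add: power2_eq_square algebra_simps)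
    qed (simp add: h_def)
    then show "AE x in lebesgue. norm (h x) \<le> norm (indicator \<Omega> x + (cmod (h x))\<^sup>2)"
      by (intro AE_I2) (metis abs_of_nonneg norm_ge_zero order_trans real_norm_def)
  qed (rule hm)
  have g1: "integrable lborel g"
  proof -
    have "integrable lebesgue g"
      by (rule integrable_cong_AE_imp[OF h1 gm]) (use g(2) in \<open>eventually_elim, simp\<close>)
    then show ?thesis using integrable_completion[of g lborel] g(1) by simp
  qed
  have g2: "integrable lborel (\<lambda>x. (cmod (g x))\<^sup>2)"
  proof -
    have "integrable lebesgue (\<lambda>x. (cmod (g x))\<^sup>2)"
    proof (rule integrable_cong_AE_imp[OF h2])
      show "(\<lambda>x. (cmod (g x))\<^sup>2) \<in> borel_measurable lebesgue" using gm by measurable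
      show "AE x in lebesgue. (cmod (h x))\<^sup>2 = (cmod (g x))\<^sup>2" using g(2) by eventually_elim simp
    qed
    then show ?thesis using integrable_completion[of "\<lambda>x. (cmod (g x))\<^sup>2" lborel] g(1) by simp
  qed
  have transfer: "(LINT x|lebesgue_on \<Omega>. v x * \<psi> x) = (LINT x|lborel. g x * \<psi> x)"
    if "continuous_on UNIV \<psi>" for \<psi> :: "'a \<Rightarrow> complex"
  proof -
    have \<psi>: "\<psi> \<in> borel_measurable borel" using that by (rule borel_measurable_continuous_onI)
    then have \<psi>': "\<psi> \<in> borel_measurable lebesgue" by (simp add: measurable_completion)
    have "(LINT x|lebesgue_on \<Omega>. v x * \<psi> x) = (LINT x|lebesgue. h x * \<psi> x)"
      unfolding integral_restrict_space[OF \<Omega>m(2)] h_def by simp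
    also have "\<dots> = (LINT x|lebesgue. g x * \<psi> x)"
    proof (rule integral_cong_AE)
      show "(\<lambda>x. h x * \<psi> x) \<in> borel_measurable lebesgue" using hm \<psi>' by measurable
      show "(\<lambda>x. g x * \<psi> x) \<in> borel_measurable lebesgue" using gm \<psi>' by measurable
      show "AE x in lebesgue. h x * \<psi> x = g x * \<psi> x" using g(2) by eventually_elim simp
    qed
    also have "\<dots> = (LINT x|lborel. g x * \<psi> x)"
      using g(1) \<psi> by (intro integral_completion) simp
    finally show ?thesis .
  qed
  have weak: "(LINT y|lborel. g y * laplacian \<phi> y) = - complex_of_real (k\<^sup>2) * (LINT y|lborel. g y * \<phi> y)"
    if \<phi>: "\<phi> \<in> test_functions \<Omega>" for \<phi>
  proof -
    have sm: "smooth \<phi>" using \<phi> by (simp add: test_functions_def)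
    have "(LINT x|lebesgue_on \<Omega>. v x * laplacian \<phi> x)
        = (LINT x|lebesgue_on \<Omega>. - complex_of_real (k\<^sup>2) * (v x * \<phi> x))"
      using v \<phi> by (simp add: helmholtz_def has_weak_laplacian_def mult.assoc)
    then have "(LINT x|lebesgue_on \<Omega>. v x * laplacian \<phi> x)
        = - complex_of_real (k\<^sup>2) * (LINT x|lebesgue_on \<Omega>. v x * \<phi> x)"
      by (simp only: integral_mult_right_zero)
    then show ?thesis
      unfolding transfer[OF smooth_imp_continuous[OF sm]]
        transfer[OF smooth_imp_continuous_laplacian[OF sm]] .
  qed
  obtain W where W: "\<And>p. p \<in> \<Omega> \<Longrightarrow> \<exists>r>0. \<exists>L. L-lipschitz_on (ball p r) W \<and> ball p r \<subseteq> \<Omega>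
      \<and> (AE x in lborel. x \<in> ball p r \<longrightarrow> W x = g x)"
    using weak_helmholtz_regularity[OF dim \<Omega>(1) g1 g2 weak] by blast
  have "AE x in lebesgue. x \<in> \<Omega> \<longrightarrow> W x = g x"
    by (rule AE_locally) (use W in blast)
  then have "AE x in lebesgue. x \<in> \<Omega> \<longrightarrow> W x = v x"
    using g(2) by eventually_elim (auto simp: h_def)
  then have "AE x in lebesgue_on \<Omega>. W x = v x" by (simp add: AE_restrict_space_iff[OF \<Omega>m(2)])
  then show thesis using W by (intro that[of W]) blast+
qed

text \<open>Two continuous representatives agree on a set of full measure, which is dense.\<close>

lemma point_value_eq:
  fixes \<Omega> :: "'a::euclidean_space set"
  assumes \<Omega>: "open \<Omega>" and W: "continuous_on \<Omega> W" "AE x in lebesgue_on \<Omega>. W x = v x" and p: "p \<in> \<Omega>"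
  shows "point_value \<Omega> v p = W p"
  unfolding point_value_def
proof (rule the_equality)
  show "\<exists>w. continuous_on \<Omega> w \<and> (AE y in lebesgue_on \<Omega>. w y = v y) \<and> w p = W p"
    using W by blast
  fix c assume "\<exists>w. continuous_on \<Omega> w \<and> (AE y in lebesgue_on \<Omega>. w y = v y) \<and> w p = c"
  then obtain w where w: "continuous_on \<Omega> w" "AE y in lebesgue_on \<Omega>. w y = v y" "w p = c" by blast
  obtain r where r: "r > 0" "cball p r \<subseteq> \<Omega>" using \<Omega> p open_contains_cball by blast
  let ?C = "{x \<in> cball p r. w x - W x = 0}"
  have "closed ?C"
    by (rule continuous_closed_preimage_constant)
      (auto intro!: continuous_on_diff continuous_on_subset[OF w(1)] continuous_on_subset[OF W(1)] r)
  moreover have "AE x in lebesgue_on \<Omega>. w x - W x = 0"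
    using w(2) W(2) by eventually_elim simp
  then have "AE x in lebesgue. x \<in> \<Omega> \<longrightarrow> w x - W x = 0"
    using \<Omega> by (subst (asm) AE_restrict_space_iff) auto
  then have "AE x\<in>ball p r in lebesgue. x \<in> ?C"
  proof eventually_elim
    case (elim x)
    show ?case
    proof
      assume "x \<in> ball p r"
      then have "x \<in> cball p r" using ball_subset_cball by blast
      with elim r(2) show "x \<in> ?C" by blast
    qed
  qed
  ultimately have "p \<in> ?C"
    by (rule mem_closed_if_AE_lebesgue_open[OF open_ball]) (use r in simp)
  then show "c = W p" using w(3) by simp
qed

section \<open>Green's identity\<close>

lemma L2_add:
  assumes "u \<in> L2 \<Omega>" "w \<in> L2 \<Omega>"
  shows "(\<lambda>x. u x + w x) \<in> L2 \<Omega>"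
proof -
  have m: "u \<in> borel_measurable (lebesgue_on \<Omega>)" "w \<in> borel_measurable (lebesgue_on \<Omega>)"
    using assms by (auto simp: L2_def)
  have m': "(\<lambda>x. u x + w x) \<in> borel_measurable (lebesgue_on \<Omega>)" using m by measurable
  have "integrable (lebesgue_on \<Omega>) (\<lambda>x. (cmod (u x + w x))\<^sup>2)"
  proof (rule Bochner_Integration.integrable_bound)
    show "integrable (lebesgue_on \<Omega>) (\<lambda>x. 2 * (cmod (u x))\<^sup>2 + 2 * (cmod (w x))\<^sup>2)"
      using assms by (intro Bochner_Integration.integrable_add integrable_mult_right) (auto simp: L2_def)
    show "(\<lambda>x. (cmod (u x + w x))\<^sup>2) \<in> borel_measurable (lebesgue_on \<Omega>)" using m' by measurable
    show "AE x in lebesgue_on \<Omega>. norm ((cmod (u x + w x))\<^sup>2) \<le> norm (2 * (cmod (u x))\<^sup>2 + 2 * (cmod (w x))\<^sup>2)"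
    proof (rule AE_I2)
      fix x
      have "(cmod (u x + w x))\<^sup>2 \<le> (cmod (u x) + cmod (w x))\<^sup>2"
        by (intro power_mono norm_triangle_ineq norm_ge_zero)
      also have "\<dots> \<le> 2 * (cmod (u x))\<^sup>2 + 2 * (cmod (w x))\<^sup>2"
        using zero_le_power2[of "cmod (u x) - cmod (w x)"] by (simp add: power2_eq_square algebra_simps)
      finally show "norm ((cmod (u x + w x))\<^sup>2) \<le> norm (2 * (cmod (u x))\<^sup>2 + 2 * (cmod (w x))\<^sup>2)"
        by simp
    qed
  qed
  with m' show ?thesis by (simp add: L2_def)
qed

lemma L2_cmult:
  assumes "u \<in> L2 \<Omega>"
  shows "(\<lambda>x. c * u x) \<in> L2 \<Omega>"
proof -
  have m: "u \<in> borel_measurable (lebesgue_on \<Omega>)" using assms by (simp add: L2_def)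
  have "(\<lambda>x. c * u x) \<in> borel_measurable (lebesgue_on \<Omega>)" using m by measurable
  then show ?thesis using assms by (simp add: L2_def norm_mult power_mult_distrib)
qed

lemma L2_mult_integrable:
  assumes "u \<in> L2 \<Omega>" "w \<in> L2 \<Omega>"
  shows "integrable (lebesgue_on \<Omega>) (\<lambda>x. u x * w x)"
proof (rule Bochner_Integration.integrable_bound)
  have m: "u \<in> borel_measurable (lebesgue_on \<Omega>)" "w \<in> borel_measurable (lebesgue_on \<Omega>)"
    using assms by (auto simp: L2_def)
  show "integrable (lebesgue_on \<Omega>) (\<lambda>x. (cmod (u x))\<^sup>2 + (cmod (w x))\<^sup>2)"
    using assms by (intro Bochner_Integration.integrable_add) (auto simp: L2_def)
  show "(\<lambda>x. u x * w x) \<in> borel_measurable (lebesgue_on \<Omega>)" using m by measurable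
  show "AE x in lebesgue_on \<Omega>. norm (u x * w x) \<le> norm ((cmod (u x))\<^sup>2 + (cmod (w x))\<^sup>2)"
  proof (rule AE_I2)
    fix x
    have "2 * (cmod (u x) * cmod (w x)) \<le> (cmod (u x))\<^sup>2 + (cmod (w x))\<^sup>2"
      using zero_le_power2[of "cmod (u x) - cmod (w x)"] by (simp add: power2_eq_square algebra_simps)
    moreover have "0 \<le> cmod (u x) * cmod (w x)" by simp
    ultimately have "cmod (u x) * cmod (w x) \<le> (cmod (u x))\<^sup>2 + (cmod (w x))\<^sup>2" by linarith
    then show "norm (u x * w x) \<le> norm ((cmod (u x))\<^sup>2 + (cmod (w x))\<^sup>2)" by (simp add: norm_mult)
  qed
qed

lemma weak_pderiv_L2:
  assumes "u \<in> H1 \<Omega>" "b \<in> Basis"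
  shows "weak_pderiv \<Omega> b u \<in> L2 \<Omega>"
proof -
  have "\<exists>w. w \<in> L2 \<Omega> \<and> has_weak_pderiv \<Omega> b u w" using assms by (auto simp: H1_def)
  from someI_ex[OF this] show ?thesis by (simp add: weak_pderiv_def)
qed

text \<open>The definition of the normal derivative allows the trace of any \<open>H\<^sup>1\<close> function to be paired
  with it, in particular that of the other solution. The volume integrals of the two pairings have the
  same gradient term.\<close>

lemma reciprocity_gap_eq_source_integral:
  fixes \<Omega> :: "'a::euclidean_space set"
  assumes u: "helmholtz \<Omega> k u s" and s: "s \<in> L2 \<Omega>" and v: "helmholtz \<Omega> k v (\<lambda>_. 0)"
    and data: "cauchy_data \<Omega> u (f, du)" "cauchy_data \<Omega> v (g, dv)"
  shows "reciprocity_gap (f, du) (g, dv) = (LINT x|lebesgue_on \<Omega>. s x * v x)"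
proof -
  let ?hu = "\<lambda>x. s x - complex_of_real (k\<^sup>2) * u x" and ?hv = "\<lambda>x. 0 - complex_of_real (k\<^sup>2) * v x"
  let ?grad = "\<lambda>u w x. \<Sum>b\<in>Basis. weak_pderiv \<Omega> b u x * weak_pderiv \<Omega> b w x"
  have H: "u \<in> H1 \<Omega>" "v \<in> H1 \<Omega>" using u v by (auto simp: helmholtz_def)
  then have uv: "u \<in> L2 \<Omega>" "v \<in> L2 \<Omega>" by (auto simp: H1_def)
  have hu: "?hu \<in> L2 \<Omega>"
    using L2_add[OF s L2_cmult[OF uv(1), of "- complex_of_real (k\<^sup>2)"]] by simp
  have hv: "?hv \<in> L2 \<Omega>" using L2_cmult[OF uv(2), of "- complex_of_real (k\<^sup>2)"] by simp
  have "du g = (LINT x|lebesgue_on \<Omega>. ?grad u v x + ?hu x * v x)"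
    using data u H hu by (auto simp: cauchy_data_def has_normal_derivative_def helmholtz_def)
  moreover have "dv f = (LINT x|lebesgue_on \<Omega>. ?grad v u x + ?hv x * u x)"
    using data v H hv by (auto simp: cauchy_data_def has_normal_derivative_def helmholtz_def)
  moreover have "integrable (lebesgue_on \<Omega>) (\<lambda>x. ?grad u v x + ?hu x * v x)"
    "integrable (lebesgue_on \<Omega>) (\<lambda>x. ?grad v u x + ?hv x * u x)"
    by (intro Bochner_Integration.integrable_add Bochner_Integration.integrable_sum L2_mult_integrable
        weak_pderiv_L2 H hu hv uv; assumption)+
  ultimately have "reciprocity_gap (f, du) (g, dv) =
      (LINT x|lebesgue_on \<Omega>. (?grad u v x + ?hu x * v x) - (?grad v u x + ?hv x * u x))"
    by (simp add: reciprocity_gap_def)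
  also have "\<dots> = (LINT x|lebesgue_on \<Omega>. s x * v x)"
  proof (rule Bochner_Integration.integral_cong[OF refl])
    fix x
    have "?grad u v x = ?grad v u x" by (simp add: mult.commute)
    then show "(?grad u v x + ?hu x * v x) - (?grad v u x + ?hv x * u x) = s x * v x"
      by (simp add: algebra_simps)
  qed
  finally show ?thesis .
qed

section \<open>Source integrals over small regions\<close>

lemma region_eq: "region z \<epsilon> S = (\<lambda>x. \<epsilon> *\<^sub>R x + z) ` S"
  by (simp add: region_def add.commute)

lemma measure_region: "\<epsilon> > 0 \<Longrightarrow> measure lebesgue (region z \<epsilon> S) = \<epsilon> ^ DIM('a) * measure lebesgue S"
  for z :: "'a::euclidean_space"
  unfolding region_eq measure_lebesgue_affine by simp

lemma open_region: "open S \<Longrightarrow> \<epsilon> > 0 \<Longrightarrow> open (region z \<epsilon> S)"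
  for z :: "'a::euclidean_space"
  using open_translation[OF open_scaling[of \<epsilon> S], of z]
  by (simp add: region_def image_image)

lemma region_subset_ball:
  fixes z :: "'a::euclidean_space"
  assumes "\<And>y. y \<in> S \<Longrightarrow> norm y \<le> R" "\<epsilon> > 0" "x \<in> region z \<epsilon> S"
  shows "dist x z \<le> \<epsilon> * R"
proof -
  obtain y where y: "y \<in> S" "x = z + \<epsilon> *\<^sub>R y" using assms(3) by (auto simp: region_def)
  then have "dist x z = \<epsilon> * norm y" using assms(2) by (simp add: dist_norm)
  then show ?thesis using assms(1)[OF y(1)] assms(2) by simp
qed

text \<open>\<open>|S| Avg(\<rho>) c\<close> is the integral of \<open>\<rho> c\<close>.\<close>

lemma source_integral_estimate:
  fixes S :: "'a::euclidean_space set"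
  assumes S: "S \<in> lmeasurable" "measure lebesgue S > 0"
    and \<rho>: "\<rho> \<in> borel_measurable (lebesgue_on S)" "AE x in lebesgue_on S. cmod (\<rho> x) \<le> M"
    and int: "integrable (lebesgue_on S) (\<lambda>x. \<rho> x * v x)"
    and v: "AE x in lebesgue_on S. cmod (v x - c) \<le> \<delta>"
  shows "cmod ((LINT x|lebesgue_on S. \<rho> x * v x) - complex_of_real (measure lebesgue S) * avg S \<rho> * c)
      \<le> \<bar>M\<bar> * \<delta> * measure lebesgue S"
proof -
  interpret finite_measure "lebesgue_on S" using S(1) by (rule finite_measure_lebesgue_on)
  have \<rho>int: "integrable (lebesgue_on S) \<rho>" using \<rho>(2,1) by (rule integrable_const_bound)
  have "complex_of_real (measure lebesgue S) * avg S \<rho> * c = (LINT x|lebesgue_on S. \<rho> x * c)"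
    using S(2) by (simp add: avg_def)
  also have "(LINT x|lebesgue_on S. \<rho> x * v x) - \<dots> = (LINT x|lebesgue_on S. \<rho> x * v x - \<rho> x * c)"
    by (rule Bochner_Integration.integral_diff[OF int, symmetric]) (rule integrable_mult_left[OF \<rho>int])
  finally have "cmod ((LINT x|lebesgue_on S. \<rho> x * v x) - complex_of_real (measure lebesgue S) * avg S \<rho> * c)
      = cmod (LINT x|lebesgue_on S. \<rho> x * v x - \<rho> x * c)" by simp
  also have "\<dots> \<le> (LINT x|lebesgue_on S. cmod (\<rho> x * v x - \<rho> x * c))" by (rule integral_norm_bound)
  also have "\<dots> \<le> (LINT x|lebesgue_on S. \<bar>M\<bar> * \<delta>)"
  proof (rule integral_mono_AE)
    show "integrable (lebesgue_on S) (\<lambda>x. cmod (\<rho> x * v x - \<rho> x * c))"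
      by (intro integrable_norm Bochner_Integration.integrable_diff int integrable_mult_left \<rho>int)
    show "integrable (lebesgue_on S) (\<lambda>x. \<bar>M\<bar> * \<delta>)" by simp
    show "AE x in lebesgue_on S. cmod (\<rho> x * v x - \<rho> x * c) \<le> \<bar>M\<bar> * \<delta>"
      using \<rho>(2) v
    proof eventually_elim
      case (elim x)
      have "cmod (\<rho> x * v x - \<rho> x * c) = cmod (\<rho> x) * cmod (v x - c)"
        by (simp add: norm_mult flip: right_diff_distrib)
      also have "\<dots> \<le> \<bar>M\<bar> * \<delta>" using elim by (intro mult_mono) auto
      finally show ?case .
    qed
  qed
  also have "\<dots> = \<bar>M\<bar> * \<delta> * measure lebesgue S"
    using S(1) by (simp add: measure_restrict_space mult.commute)
  finally show ?thesis .
qed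

lemma region_integral_bigo:
  fixes z :: "'a::euclidean_space"
  assumes S: "open S" "S \<noteq> {}" "bounded S"
    and W: "AE x in lebesgue_on \<Omega>. W x = v x" "L-lipschitz_on (ball z r) W" "r > 0"
      "ball z r \<subseteq> \<Omega>" "open \<Omega>"
    and \<rho>: "\<And>\<epsilon>. 0 < \<epsilon> \<Longrightarrow> \<epsilon> < \<epsilon>\<^sub>0 \<Longrightarrow> \<rho> \<epsilon> \<in> borel_measurable (lebesgue_on (region z \<epsilon> S))"
      "\<And>\<epsilon>. 0 < \<epsilon> \<Longrightarrow> \<epsilon> < \<epsilon>\<^sub>0 \<Longrightarrow> AE x in lebesgue_on (region z \<epsilon> S). cmod (\<rho> \<epsilon> x) \<le> M"
      "\<And>\<epsilon>. 0 < \<epsilon> \<Longrightarrow> \<epsilon> < \<epsilon>\<^sub>0 \<Longrightarrow> integrable (lebesgue_on (region z \<epsilon> S)) (\<lambda>x. \<rho> \<epsilon> x * v x)"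
    and \<epsilon>\<^sub>0: "\<epsilon>\<^sub>0 > 0"
  shows "\<exists>C. \<forall>\<^sub>F \<epsilon> in at_right 0.
     cmod ((LINT x|lebesgue_on (region z \<epsilon> S). \<rho> \<epsilon> x * v x) -
       complex_of_real (\<epsilon> ^ DIM('a)) * (complex_of_real (measure lebesgue S) * avg (region z \<epsilon> S) (\<rho> \<epsilon>) * W z))
     \<le> C * \<epsilon> ^ (DIM('a) + 1)"
proof -
  obtain R where R: "R > 0" "\<And>y. y \<in> S \<Longrightarrow> norm y \<le> R" using S(3) unfolding bounded_pos by blast
  let ?C = "\<bar>M\<bar> * (L * R) * measure lebesgue S"
  have Sm: "S \<in> lmeasurable" using S by (intro lmeasurable_open)
  have pos: "measure lebesgue S > 0"
  proof -
    obtain y t where t: "t > 0" "ball y t \<subseteq> S" using S(1,2) openE by blast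
    then have "measure lebesgue (ball y t) \<le> measure lebesgue S"
      by (intro measure_mono_fmeasurable Sm) auto
    moreover have "measure lebesgue (ball y t) > 0" using content_ball_pos[OF t(1), of y] by simp
    ultimately show ?thesis by linarith
  qed
  have L: "L \<ge> 0" using W(2) by (rule lipschitz_on_nonneg)
  have "\<forall>\<^sub>F \<epsilon> in at_right 0. \<epsilon> \<in> {0<..<min \<epsilon>\<^sub>0 (r / R)}"
    using \<epsilon>\<^sub>0 W(3) R(1) by (intro eventually_at_right_real) simp
  then have "\<forall>\<^sub>F \<epsilon> in at_right 0.
     cmod ((LINT x|lebesgue_on (region z \<epsilon> S). \<rho> \<epsilon> x * v x) -
       complex_of_real (\<epsilon> ^ DIM('a)) * (complex_of_real (measure lebesgue S) * avg (region z \<epsilon> S) (\<rho> \<epsilon>) * W z))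
     \<le> ?C * \<epsilon> ^ (DIM('a) + 1)"
  proof eventually_elim
    case (elim \<epsilon>)
    then have \<epsilon>: "0 < \<epsilon>" "\<epsilon> < \<epsilon>\<^sub>0" "\<epsilon> * R < r" using R(1) by (auto simp: field_simps)
    let ?D = "region z \<epsilon> S"
    have sub: "?D \<subseteq> ball z r"
      using region_subset_ball[OF R(2) \<epsilon>(1)] \<epsilon>(3) by (fastforce simp: dist_commute)
    have D: "open ?D" "?D \<in> lmeasurable"
      using open_region[OF S(1) \<epsilon>(1)] bounded_subset[OF bounded_ball sub] by (auto intro: lmeasurable_open)
    have m: "measure lebesgue ?D = \<epsilon> ^ DIM('a) * measure lebesgue S" by (rule measure_region[OF \<epsilon>(1)])
    have "AE x in lebesgue. x \<in> \<Omega> \<longrightarrow> W x = v x"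
      using W(1,5) by (subst (asm) AE_restrict_space_iff) auto
    then have "AE x in lebesgue. x \<in> ?D \<longrightarrow> cmod (v x - W z) \<le> L * (\<epsilon> * R)"
    proof eventually_elim
      case (elim x)
      show ?case
      proof
        assume x: "x \<in> ?D"
        then have xb: "x \<in> ball z r" using sub by blast
        then have "v x = W x" using elim W(4) by auto
        then have "cmod (v x - W z) = dist (W x) (W z)" by (simp add: dist_norm)
        also have "\<dots> \<le> L * dist x z" using xb W(3) by (intro lipschitz_onD[OF W(2)]) auto
        also have "\<dots> \<le> L * (\<epsilon> * R)"
          by (intro mult_left_mono region_subset_ball[OF R(2) \<epsilon>(1) x] L)
        finally show "cmod (v x - W z) \<le> L * (\<epsilon> * R)" .
      qed
    qed
    then have AE: "AE x in lebesgue_on ?D. cmod (v x - W z) \<le> L * (\<epsilon> * R)"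
      using D(1) by (subst AE_restrict_space_iff) auto
    have "cmod ((LINT x|lebesgue_on ?D. \<rho> \<epsilon> x * v x) - complex_of_real (measure lebesgue ?D) * avg ?D (\<rho> \<epsilon>) * W z)
        \<le> \<bar>M\<bar> * (L * (\<epsilon> * R)) * measure lebesgue ?D"
      by (rule source_integral_estimate[OF D(2) _ \<rho>(1)[OF \<epsilon>(1,2)] \<rho>(2)[OF \<epsilon>(1,2)] \<rho>(3)[OF \<epsilon>(1,2)] AE])
        (use pos \<epsilon> in \<open>simp add: m\<close>)
    then show ?case unfolding m by (simp add: mult_ac)
  qed
  then show ?thesis by blast
qed

lemma L2_bounded_source:
  fixes \<Omega> :: "'a::euclidean_space set"
  assumes \<Omega>: "open \<Omega>" "bounded \<Omega>" and D: "open D" "D \<subseteq> \<Omega>"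
    and \<rho>: "\<rho> \<in> borel_measurable (lebesgue_on D)" "AE x in lebesgue_on D. cmod (\<rho> x) \<le> M"
  shows "(\<lambda>x. \<rho> x * indicator D x) \<in> L2 \<Omega>"
proof -
  let ?s = "\<lambda>x. \<rho> x * indicator D x"
  have Dm: "D \<inter> space lebesgue \<in> sets lebesgue" "\<Omega> \<inter> space lebesgue \<in> sets lebesgue"
    using D \<Omega> by auto
  have "(\<lambda>x. indicator D x *\<^sub>R \<rho> x) \<in> borel_measurable lebesgue"
    using \<rho>(1) unfolding borel_measurable_restrict_space_iff[OF Dm(1)] .
  also have "(\<lambda>x. indicator D x *\<^sub>R \<rho> x) = ?s" by (auto simp: indicator_def)
  finally have m: "?s \<in> borel_measurable (lebesgue_on \<Omega>)" by (rule measurable_restrict_space1)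
  interpret finite_measure "lebesgue_on \<Omega>"
    using \<Omega> by (intro finite_measure_lebesgue_on lmeasurable_open)
  have "AE x in lebesgue. x \<in> D \<longrightarrow> cmod (\<rho> x) \<le> M"
    using \<rho>(2) by (simp add: AE_restrict_space_iff[OF Dm(1)])
  then have "AE x in lebesgue. x \<in> \<Omega> \<longrightarrow> norm ((cmod (?s x))\<^sup>2) \<le> \<bar>M\<bar>\<^sup>2"
  proof eventually_elim
    case (elim x)
    then have "cmod (?s x) \<le> \<bar>M\<bar>" by (auto simp: indicator_def)
    then have "(cmod (?s x))\<^sup>2 \<le> \<bar>M\<bar>\<^sup>2" by (intro power_mono) auto
    then show ?case by simp
  qed
  then have "AE x in lebesgue_on \<Omega>. norm ((cmod (?s x))\<^sup>2) \<le> \<bar>M\<bar>\<^sup>2"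
    by (simp add: AE_restrict_space_iff[OF Dm(2)])
  moreover have "(\<lambda>x. (cmod (?s x))\<^sup>2) \<in> borel_measurable (lebesgue_on \<Omega>)" using m by measurable
  ultimately have "integrable (lebesgue_on \<Omega>) (\<lambda>x. (cmod (?s x))\<^sup>2)" by (rule integrable_const_bound)
  with m show ?thesis by (simp add: L2_def)
qed

lemma integral_indicator_UNION:
  fixes h \<rho> :: "'a::euclidean_space \<Rightarrow> complex"
  assumes \<Omega>: "open \<Omega>" and D: "finite I" "\<And>j. j \<in> I \<Longrightarrow> open (D j)" "disjoint_family_on D I"
      "(\<Union>j\<in>I. D j) \<subseteq> \<Omega>"
    and int: "integrable (lebesgue_on \<Omega>) (\<lambda>x. \<rho> x * indicator (\<Union>j\<in>I. D j) x * h x)"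
  shows "j \<in> I \<Longrightarrow> integrable (lebesgue_on (D j)) (\<lambda>x. \<rho> x * h x)"
    and "(LINT x|lebesgue_on \<Omega>. \<rho> x * indicator (\<Union>j\<in>I. D j) x * h x)
      = (\<Sum>j\<in>I. LINT x|lebesgue_on (D j). \<rho> x * h x)"
proof -
  have m: "\<Omega> \<inter> space lebesgue \<in> sets lebesgue"
    "\<And>j. j \<in> I \<Longrightarrow> D j \<inter> space lebesgue \<in> sets lebesgue" using \<Omega> D(2) by auto
  let ?U = "\<Union>j\<in>I. D j"
  have U: "integrable lebesgue (\<lambda>x. indicator \<Omega> x *\<^sub>R (\<rho> x * indicator ?U x * h x))"
    using int unfolding integrable_restrict_space[OF m(1)] .
  have eq: "indicator \<Omega> x *\<^sub>R (\<rho> x * indicator ?U x * h x)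
      = (\<Sum>j\<in>I. indicator (D j) x *\<^sub>R (\<rho> x * h x))" for x
  proof -
    have "indicator \<Omega> x *\<^sub>R (\<rho> x * indicator ?U x * h x) = indicator ?U x *\<^sub>R (\<rho> x * h x)"
      using D(4) by (auto simp: indicator_def)
    also have "indicator ?U x = (\<Sum>j\<in>I. indicator (D j) x :: real)"
      using indicator_UN_disjoint[OF D(1,3)] by metis
    finally show ?thesis by (simp add: scaleR_left.sum)
  qed
  have int': "integrable lebesgue (\<lambda>x. indicator (D j) x *\<^sub>R (\<rho> x * h x))" if j: "j \<in> I" for j
  proof -
    have "(\<lambda>x. indicator (D j) x *\<^sub>R (\<rho> x * h x))
        = (\<lambda>x. indicator (D j) x *\<^sub>R (indicator \<Omega> x *\<^sub>R (\<rho> x * indicator ?U x * h x)))"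
      using j D(4) by (auto simp: indicator_def fun_eq_iff)
    then show ?thesis using integrable_mult_indicator[OF _ U, of "D j"] D(2)[OF j] by simp
  qed
  then show "j \<in> I \<Longrightarrow> integrable (lebesgue_on (D j)) (\<lambda>x. \<rho> x * h x)"
    using integrable_restrict_space[OF m(2)] by blast
  have "(LINT x|lebesgue_on \<Omega>. \<rho> x * indicator ?U x * h x)
      = (LINT x|lebesgue. (\<Sum>j\<in>I. indicator (D j) x *\<^sub>R (\<rho> x * h x)))"
    unfolding integral_restrict_space[OF m(1)] eq ..
  also have "\<dots> = (\<Sum>j\<in>I. LINT x|lebesgue. indicator (D j) x *\<^sub>R (\<rho> x * h x))"
    by (rule Bochner_Integration.integral_sum) (rule int')
  also have "\<dots> = (\<Sum>j\<in>I. LINT x|lebesgue_on (D j). \<rho> x * h x)"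
    by (rule sum.cong[OF refl]) (simp add: integral_restrict_space[OF m(2)])
  finally show "(LINT x|lebesgue_on \<Omega>. \<rho> x * indicator ?U x * h x)
      = (\<Sum>j\<in>I. LINT x|lebesgue_on (D j). \<rho> x * h x)" .
qed

theorem mainTheorem4:
  fixes \<Omega> :: "'a::euclidean_space set"
    and k c\<^sub>0 \<epsilon>\<^sub>0 M :: real
    and J :: nat
    and z :: "nat \<Rightarrow> 'a"
    and B :: "nat \<Rightarrow> 'a set"
    and \<rho> u :: "real \<Rightarrow> 'a \<Rightarrow> complex"
    and f g v :: "'a \<Rightarrow> complex"
    and dnu :: "real \<Rightarrow> ('a \<Rightarrow> complex) \<Rightarrow> complex"
    and dnv :: "('a \<Rightarrow> complex) \<Rightarrow> complex"
  assumes dim: "DIM('a) \<in> {2, 3}"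
    and Omega: "open \<Omega>" "bounded \<Omega>" "simply_connected \<Omega>" "lipschitz_boundary \<Omega>"
    and k: "k > 0" "\<not> dirichlet_eigenvalue \<Omega> (k\<^sup>2)"
    and J: "J \<ge> 1"
    and z: "\<forall>j\<in>{1..J}. z j \<in> \<Omega>"
    and sep: "c\<^sub>0 > 0" "\<forall>i\<in>{1..J}. \<forall>j\<in>{1..J}. i \<noteq> j \<longrightarrow> dist (z i) (z j) \<ge> c\<^sub>0"
    and B: "\<forall>j\<in>{1..J}. open (B j) \<and> connected (B j) \<and> B j \<noteq> {} \<and> bounded (B j) \<and>
              lipschitz_boundary (B j) \<and> centered_at_origin (B j)"
    and eps0: "\<epsilon>\<^sub>0 > 0"
    and D: "\<forall>\<epsilon>\<in>{0<..<\<epsilon>\<^sub>0}. disjoint_family_on (\<lambda>j. region (z j) \<epsilon> (B j)) {1..J} \<and>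
              regions J z B \<epsilon> \<subseteq> \<Omega> \<and> setdist (regions J z B \<epsilon>) (frontier \<Omega>) > 0"
    and rho: "\<forall>\<epsilon>\<in>{0<..<\<epsilon>\<^sub>0}. \<rho> \<epsilon> \<in> borel_measurable (lebesgue_on (regions J z B \<epsilon>)) \<and>
              (AE x in lebesgue_on (regions J z B \<epsilon>). cmod (\<rho> \<epsilon> x) \<le> M)"
    and f: "f \<in> H_half \<Omega>"
    and u: "\<forall>\<epsilon>\<in>{0<..<\<epsilon>\<^sub>0}. helmholtz \<Omega> k (u \<epsilon>) (\<lambda>x. \<rho> \<epsilon> x * indicator (regions J z B \<epsilon>) x) \<and>
              has_trace \<Omega> (u \<epsilon>) f"
    and v: "helmholtz \<Omega> k v (\<lambda>_. 0)"
    and data_u: "\<forall>\<epsilon>\<in>{0<..<\<epsilon>\<^sub>0}. cauchy_data \<Omega> (u \<epsilon>) (f, dnu \<epsilon>)"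
    and data_v: "cauchy_data \<Omega> v (g, dnv)"
  shows "(\<lambda>\<epsilon>. cmod (reciprocity_gap (f, dnu \<epsilon>) (g, dnv) -
            complex_of_real (\<epsilon> ^ DIM('a)) *
              (\<Sum>j=1..J. complex_of_real (measure lebesgue (B j)) *
                 avg (region (z j) \<epsilon> (B j)) (\<rho> \<epsilon>) * point_value \<Omega> v (z j))))
          \<in> O[at_right 0](\<lambda>\<epsilon>. \<epsilon> ^ (DIM('a) + 1))"
proof -
  let ?D = "\<lambda>\<epsilon> j. region (z j) \<epsilon> (B j)"
  have "DIM('a) \<le> 3" using dim by auto
  then obtain W where W: "AE x in lebesgue_on \<Omega>. W x = v x"
    "\<And>p. p \<in> \<Omega> \<Longrightarrow> \<exists>r>0. \<exists>L. L-lipschitz_on (ball p r) W \<and> ball p r \<subseteq> \<Omega>"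
    using helmholtz_regular_representative[OF _ Omega(1,2) v] by blast
  have "isCont W p" if p: "p \<in> \<Omega>" for p
  proof -
    obtain r L where "r > 0" "L-lipschitz_on (ball p r) W" using W(2)[OF p] by blast
    then show ?thesis
      using lipschitz_on_continuous_on[of L "ball p r" W] by (simp add: continuous_on_eq_continuous_at)
  qed
  then have "continuous_on \<Omega> W" by (simp add: continuous_at_imp_continuous_on)
  then have point: "point_value \<Omega> v (z j) = W (z j)" if "j \<in> {1..J}" for j
    using point_value_eq[OF Omega(1) _ W(1)] z that by blast
  let ?I = "\<lambda>\<epsilon> j. LINT x|lebesgue_on (?D \<epsilon> j). \<rho> \<epsilon> x * v x"
  let ?T = "\<lambda>\<epsilon> j. complex_of_real (\<epsilon> ^ DIM('a)) *
    (complex_of_real (measure lebesgue (B j)) * avg (?D \<epsilon> j) (\<rho> \<epsilon>) * W (z j))"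
  have opn: "open (?D \<epsilon> j)" if "\<epsilon> > 0" "j \<in> {1..J}" for \<epsilon> j
    using B that by (intro open_region) auto
  have v2: "v \<in> L2 \<Omega>" using v by (simp add: helmholtz_def H1_def)
  have source: "(\<lambda>x. \<rho> \<epsilon> x * indicator (regions J z B \<epsilon>) x) \<in> L2 \<Omega>" if "0 < \<epsilon>" "\<epsilon> < \<epsilon>\<^sub>0" for \<epsilon>
  proof (rule L2_bounded_source[OF Omega(1,2)])
    show "open (regions J z B \<epsilon>)" using opn that by (auto simp: regions_def)
  qed (use D rho that in auto)
  have split: "\<And>j. j \<in> {1..J} \<Longrightarrow> integrable (lebesgue_on (?D \<epsilon> j)) (\<lambda>x. \<rho> \<epsilon> x * v x)"
      "reciprocity_gap (f, dnu \<epsilon>) (g, dnv) = (\<Sum>j=1..J. ?I \<epsilon> j)" if \<epsilon>: "0 < \<epsilon>" "\<epsilon> < \<epsilon>\<^sub>0" for \<epsilon>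
  proof -
    have "integrable (lebesgue_on \<Omega>) (\<lambda>x. \<rho> \<epsilon> x * indicator (regions J z B \<epsilon>) x * v x)"
      by (rule L2_mult_integrable[OF source[OF \<epsilon>] v2])
    note S = integral_indicator_UNION[OF Omega(1) finite_atLeastAtMost opn[OF \<epsilon>(1)] _ _ this[unfolded regions_def]]
    have dis: "disjoint_family_on (?D \<epsilon>) {1..J}" "(\<Union>j\<in>{1..J}. ?D \<epsilon> j) \<subseteq> \<Omega>"
      using D \<epsilon> by (auto simp: regions_def)
    show "\<And>j. j \<in> {1..J} \<Longrightarrow> integrable (lebesgue_on (?D \<epsilon> j)) (\<lambda>x. \<rho> \<epsilon> x * v x)"
      by (rule S(1)[OF _ dis])
    have "reciprocity_gap (f, dnu \<epsilon>) (g, dnv)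
        = (LINT x|lebesgue_on \<Omega>. \<rho> \<epsilon> x * indicator (regions J z B \<epsilon>) x * v x)"
      using u data_u data_v \<epsilon>
      by (intro reciprocity_gap_eq_source_integral[OF _ source[OF \<epsilon>] v]) auto
    then show "reciprocity_gap (f, dnu \<epsilon>) (g, dnv) = (\<Sum>j=1..J. ?I \<epsilon> j)"
      unfolding regions_def using S(2)[OF _ dis] by simp
  qed
  have "\<exists>C. \<forall>\<^sub>F \<epsilon> in at_right 0. cmod (?I \<epsilon> j - ?T \<epsilon> j) \<le> C * \<epsilon> ^ (DIM('a) + 1)" if j: "j \<in> {1..J}" for j
  proof -
    obtain r L where rL: "r > 0" "L-lipschitz_on (ball (z j) r) W" "ball (z j) r \<subseteq> \<Omega>"
      using W(2) z j by blast
    have sub: "?D \<epsilon> j \<subseteq> regions J z B \<epsilon>" for \<epsilon> using j by (auto simp: regions_def)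
    show ?thesis
    proof (rule region_integral_bigo[OF _ _ _ W(1) rL(2,1,3) Omega(1) _ _ _ eps0])
      show "open (B j)" "B j \<noteq> {}" "bounded (B j)" using B j by auto
      fix \<epsilon> :: real assume \<epsilon>: "0 < \<epsilon>" "\<epsilon> < \<epsilon>\<^sub>0"
      then have \<rho>: "\<rho> \<epsilon> \<in> borel_measurable (lebesgue_on (regions J z B \<epsilon>))"
        "AE x in lebesgue_on (regions J z B \<epsilon>). cmod (\<rho> \<epsilon> x) \<le> M" using rho by auto
      show "\<rho> \<epsilon> \<in> borel_measurable (lebesgue_on (?D \<epsilon> j))"
        by (rule measurable_restrict_mono[OF \<rho>(1) sub])
      have "open (regions J z B \<epsilon>)" using opn \<epsilon> by (auto simp: regions_def)
      then have "AE x in lebesgue. x \<in> regions J z B \<epsilon> \<longrightarrow> cmod (\<rho> \<epsilon> x) \<le> M"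
        using \<rho>(2) by (subst (asm) AE_restrict_space_iff) auto
      then have "AE x in lebesgue. x \<in> ?D \<epsilon> j \<longrightarrow> cmod (\<rho> \<epsilon> x) \<le> M"
        by eventually_elim (use sub in blast)
      then show "AE x in lebesgue_on (?D \<epsilon> j). cmod (\<rho> \<epsilon> x) \<le> M"
        using opn[OF \<epsilon>(1) j] by (subst AE_restrict_space_iff) auto
      show "integrable (lebesgue_on (?D \<epsilon> j)) (\<lambda>x. \<rho> \<epsilon> x * v x)" by (rule split(1)[OF \<epsilon> j])
    qed
  qed
  then have "\<forall>j\<in>{1..J}. \<exists>C. \<forall>\<^sub>F \<epsilon> in at_right 0. cmod (?I \<epsilon> j - ?T \<epsilon> j) \<le> C * \<epsilon> ^ (DIM('a) + 1)"
    by (intro ballI)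
  from bchoice[OF this] obtain C where C: "\<forall>j\<in>{1..J}.
      \<forall>\<^sub>F \<epsilon> in at_right 0. cmod (?I \<epsilon> j - ?T \<epsilon> j) \<le> C j * \<epsilon> ^ (DIM('a) + 1)" ..
  have "\<forall>\<^sub>F \<epsilon> in at_right 0. \<forall>j\<in>{1..J}. cmod (?I \<epsilon> j - ?T \<epsilon> j) \<le> C j * \<epsilon> ^ (DIM('a) + 1)"
    by (rule eventually_ball_finite[OF finite_atLeastAtMost C])
  moreover have "\<forall>\<^sub>F \<epsilon> in at_right 0. \<epsilon> \<in> {0<..<\<epsilon>\<^sub>0}"
    using eps0 by (rule eventually_at_right_real)
  ultimately have "\<forall>\<^sub>F \<epsilon> in at_right 0. norm (cmod (reciprocity_gap (f, dnu \<epsilon>) (g, dnv) -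
            complex_of_real (\<epsilon> ^ DIM('a)) *
              (\<Sum>j=1..J. complex_of_real (measure lebesgue (B j)) *
                 avg (?D \<epsilon> j) (\<rho> \<epsilon>) * point_value \<Omega> v (z j))))
          \<le> (\<Sum>j=1..J. C j) * norm (\<epsilon> ^ (DIM('a) + 1))"
  proof eventually_elim
    case (elim \<epsilon>)
    then have \<epsilon>: "0 < \<epsilon>" "\<epsilon> < \<epsilon>\<^sub>0" by auto
    have "complex_of_real (\<epsilon> ^ DIM('a)) *
              (\<Sum>j=1..J. complex_of_real (measure lebesgue (B j)) *
                 avg (?D \<epsilon> j) (\<rho> \<epsilon>) * point_value \<Omega> v (z j)) = (\<Sum>j=1..J. ?T \<epsilon> j)"
      unfolding sum_distrib_left by (rule sum.cong) (simp_all add: point)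
    then have "cmod (reciprocity_gap (f, dnu \<epsilon>) (g, dnv) -
            complex_of_real (\<epsilon> ^ DIM('a)) *
              (\<Sum>j=1..J. complex_of_real (measure lebesgue (B j)) *
                 avg (?D \<epsilon> j) (\<rho> \<epsilon>) * point_value \<Omega> v (z j))) = cmod (\<Sum>j=1..J. ?I \<epsilon> j - ?T \<epsilon> j)"
      by (simp only: split(2)[OF \<epsilon>] sum_subtractf)
    also have "\<dots> \<le> (\<Sum>j=1..J. C j * \<epsilon> ^ (DIM('a) + 1))"
      by (rule sum_norm_le) (use elim(1) in blast)
    also have "\<dots> = (\<Sum>j=1..J. C j) * \<epsilon> ^ (DIM('a) + 1)" by (rule sum_distrib_right[symmetric])
    finally show ?case using \<epsilon>(1) by simp
  qed
  then show ?thesis by (rule bigoI)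
qed

end
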